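(* Let $b,c\in\mathbb{C}$ satisfy $b\notin\mathbb{Z}_{\le 0}$, $c\notin\mathbb{Z}_{\le 0}$, $c-b\notin\mathbb{Z}_{\le 0}$, and let $z\in(-\infty,1)$. Let $\mathcal{E}^*_n(b,c;z)$ be the truncation error of the specialized Gauss continued fraction for ${}_2F_1(1,b;c;z)$ (defined in the context). Then, as $n\to\infty$, $$\mathcal{E}^*_n(b,c;z)\sim\frac{2\pi\,\Gamma(c)}{\Gamma(b)\,\Gamma(c-b)}\cdot\frac{z\,(1-z)^{c-b-1}}{(1+\sqrt{1-z})^{2c}}\left\{\frac{z}{(1+\sqrt{1-z})^2}\right\}^{n}.$$
   Context: ${}_2F_1(a,b;c;z)$ denotes Gauss's hypergeometric series and its analytic continuation to $\mathbb{C}\setminus[1,\infty)$. Put $R^*(0):=1$ and, for $m\in\mathbb{Z}_{\ge 0}$, $$R^*(2m+1):=-\frac{(m+b)(m+c-1)z}{(2m+c-1)(2m+c)},\qquad R^*(2m+2):=-\frac{(m+1)(m+c-b)z}{(2m+c)(2m+c+1)},$$ where for $m=0$ the common factor $c-1$ is cancelled, so that $R^*(1)=-bz/c$ (also when $c=1$). The $n$-th truncation is $$K^*_n:=\cfrac{R^*(0)}{1+\cfrac{R^*(1)}{1+\cfrac{\ddots}{1+\cfrac{R^*(n)}{1}}}},$$ and $\mathcal{E}^*_n(b,c;z):={}_2F_1(1,b;c;z)-K^*_n$. For sequences $\{\alpha_n\},\{\beta_n\}$, the notation $\alpha_n\sim\beta_n$ means $\alpha_n/\beta_n=1+O(n^{-1/2})$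 as $n\to\infty$; when $\beta_n=0$ for all large $n$ (the trivial case $z=0$) it is read as $\alpha_n=\beta_n(1+O(n^{-1/2}))$, i.e. $\alpha_n=0$ for all large $n$. Powers of positive reals with complex exponent are $x^s=e^{s\log x}$ with real logarithm; square roots of positive reals are positive. *)

theory Defs
  imports "HOL-Complex_Analysis.Complex_Analysis"
begin

definition slit_plane :: "complex set" where
  "slit_plane = - (complex_of_real ` {1..})"

(* Gauss's series on the unit disc, continued analytically to slit_plane. The value is
   determined by uniqueness of the continuation, see hyp2F1_eqI; it carries no meaning for
   z outside slit_plane or c in {0, -1, -2, ...}. *)
definition hyp2F1 :: "complex \<Rightarrow> complex \<Rightarrow> complex \<Rightarrow> complex \<Rightarrow> complex" where
  "hyp2F1 a b c z = (THE w. \<exists>f. f holomorphic_on slit_plane \<and>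
     (\<forall>u\<in>ball 0 1. f u = eval_fps (fps_hypergeo [a, b] [c] 1) u) \<and>
     f z = w)"

lemma eval_fps_hypergeo_21:
  "eval_fps (fps_hypergeo [a, b] [c] 1) u =
     (\<Sum>n. pochhammer a n * pochhammer b n / (pochhammer c n * fact n) * u ^ n)"
  by (simp add: eval_fps_def)

lemma open_slit_plane: "open slit_plane"
  unfolding slit_plane_def by (intro open_Compl closed_slot_right)

lemma connected_slit_plane: "connected slit_plane"
  unfolding slit_plane_def
  by (intro starlike_imp_connected starlike_slotted_complex_plane_right)

lemma ball_subset_slit_plane: "ball 0 1 \<subseteq> slit_plane"
  by (auto simp: slit_plane_def)

lemma hyp2F1_eqI:
  assumes f: "f holomorphic_on slit_plane"
    and f_ser: "\<And>u. norm u < 1 \<Longrightarrow> f u = eval_fps (fps_hypergeo [a, b] [c] 1) u"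
    and z: "z \<in> slit_plane"
  shows "hyp2F1 a b c z = f z"
  unfolding hyp2F1_def
proof (rule the_equality)
  show "\<exists>g. g holomorphic_on slit_plane \<and>
     (\<forall>u\<in>ball 0 1. g u = eval_fps (fps_hypergeo [a, b] [c] 1) u) \<and>
     g z = f z"
    using f f_ser by (intro exI[of _ f]) auto
next
  fix w
  assume "\<exists>g. g holomorphic_on slit_plane \<and>
     (\<forall>u\<in>ball 0 1. g u = eval_fps (fps_hypergeo [a, b] [c] 1) u) \<and>
     g z = w"
  then obtain g where g: "g holomorphic_on slit_plane" "g z = w"
    and g_ser: "\<And>u. norm u < 1 \<Longrightarrow> g u = eval_fps (fps_hypergeo [a, b] [c] 1) u"
    by auto
  have "g z = f z"
    by (rule analytic_continuation_open[of "ball 0 1" slit_plane g f])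
      (use g f g_ser f_ser z open_slit_plane connected_slit_plane ball_subset_slit_plane in auto)
  with g show "w = f z"
    by simp
qed

(* Partial numerators of the continued fraction; index 1 is separate because there
   the common factor c - 1 is cancelled. *)
definition Rstar :: "complex \<Rightarrow> complex \<Rightarrow> complex \<Rightarrow> nat \<Rightarrow> complex" where
  "Rstar b c z n =
     (if n = 0 then 1
      else if n = 1 then - (b * z / c)
      else if odd n then
        (let m = of_nat ((n - 1) div 2)
         in - ((m + b) * (m + c - 1) * z / ((2 * m + c - 1) * (2 * m + c))))
      else
        (let m = of_nat ((n - 2) div 2)
         in - ((m + 1) * (m + c - b) * z / ((2 * m + c) * (2 * m + c + 1)))))"

lemma Rstar_0: "Rstar b c z 0 = 1"
  by (simp add: Rstar_def)

lemma Rstar_odd: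
  assumes "m > 0 \<or> c \<noteq> 1"
  shows "Rstar b c z (2 * m + 1) =
     - ((of_nat m + b) * (of_nat m + c - 1) * z / ((2 * of_nat m + c - 1) * (2 * of_nat m + c)))"
  using assms by (cases m) (auto simp: Rstar_def Let_def)

lemma Rstar_even:
  "Rstar b c z (2 * m + 2) =
     - ((of_nat m + 1) * (of_nat m + c - b) * z / ((2 * of_nat m + c) * (2 * of_nat m + c + 1)))"
  by (simp add: Rstar_def Let_def)

(* cfrac R k j = R k / (1 + R (k+1) / (1 + ... / (1 + R (k+j) / 1))).
   A vanishing denominator is subject to the convention x / 0 = 0 instead of x / 0 = \<infinity>.
   For Rstar with z < 1 and admissible b, c the denominators 1 + ... are nonzero from some
   truncation index on, so asymptotics are unaffected. *)
primrec cfrac :: "(nat \<Rightarrow> complex) \<Rightarrow> nat \<Rightarrow> nat \<Rightarrow> complex" where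
  "cfrac R k 0 = R k / 1"
| "cfrac R k (Suc j) = R k / (1 + cfrac R (Suc k) j)"

definition Kstar :: "complex \<Rightarrow> complex \<Rightarrow> complex \<Rightarrow> nat \<Rightarrow> complex" where
  "Kstar b c z n = cfrac (Rstar b c z) 0 n"

definition trunc_err :: "complex \<Rightarrow> complex \<Rightarrow> complex \<Rightarrow> nat \<Rightarrow> complex" where
  "trunc_err b c z n = hyp2F1 1 b c z - Kstar b c z n"

(* \<alpha> = \<beta> * (1 + O(n powr (-1/2))); x / 0 = 0 would make the quotient form false when \<beta> vanishes
   eventually, hence the case distinction. *)
definition asymp_half :: "(nat \<Rightarrow> complex) \<Rightarrow> (nat \<Rightarrow> complex) \<Rightarrow> bool" where
  "asymp_half \<alpha> \<beta> \<longleftrightarrow>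
     (if \<forall>\<^sub>F n in sequentially. \<beta> n = 0
      then \<forall>\<^sub>F n in sequentially. \<alpha> n = 0
      else (\<lambda>n. \<alpha> n / \<beta> n - 1) \<in> O(\<lambda>n. complex_of_real (real n powr (- 1 / 2))))"

end

(* Let P_n = F(ceil(n/2), b + floor(n/2); c + n - 1; z).  Gauss's contiguous relations say that
   P_n = P_{n+1} + R*(n+1) P_{n+2} with P_0 = 1, so e_n = (-1)^(n+1) R*(1) ... R*(n+1) P_{n+2}
   solves the three-term recurrence of the denominators B_n of the continued fraction, and the
   truncation error is e_n / B_n.  By the Casoratian, B_n / e_n is a sum of the terms
   1 / T_k with T_k = (-1)^(k+1) R*(1) ... R*(k+1) P_{k+1} P_{k+2}.  Since T_{k+1} / T_k tends to
   w = z / (1 + sqrt (1 - z))^2 and |w| < 1, this sum is asymptotic to 1 / ((1 - w) T_n), so the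
   error is asymptotic to (1 - w) T_n.

   The P_n in turn are Euler integrals of (t (1 - t) / (1 - z t))^m times a fixed function.  With
   s = sqrt (1 - z) and u = (1 - (1 + s) t) / sqrt (1 - z t) one has
   (1 + s)^2 t (1 - t) / (1 - z t) = 1 - u^2, and u decreases from 1 to -1, so Laplace's method
   reduces to the Wallis integral of (1 - u^2)^m. *)
theory Submission
  imports Defs
begin

text \<open>Three obstacles shape the proof. Euler's integral is taken in the integer upper
  parameter, with integrand t^m (1 - t)^(c+m-2) (1 - z t)^(-b-m) at odd indices: b is then
  arbitrary, but Re c + m must be large. Hence P_n is continued analytically by integrals for large
  n and by the recurrence downwards from there, which reaches P_1 = F(1, b; c; z). The truncations
  obey x / 0 = 0, so they are quotients of continuants only once all inner denominators are known to
  be nonzero: those of far tails by the parabola theorem, since R*(n) tends to -z/4, and the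
  finitely many others by the asymptotics that serve for B_n. The relative error must be
  O(n^(-1/2)). It arises from two integrals: that of |u| (1 - u^2)^m is of order 1/m, the Wallis
  integral of order m^(-1/2). T_n is computed explicitly at even n only; the odd ones follow from
  the ratio w. For z = 0 all R*(n) with n > 0 vanish and the ratios lose their meaning, so this case
  stands apart.\<close>

subsection \<open>Convergence with rate\<close>

text \<open>The error term of \<open>asymp_half\<close> turned into a notion of limit. It is closed
  under arithmetic, so the rate is carried along by limit calculus and has to be estimated only at
  the sources.\<close>

definition tends_half :: "(nat \<Rightarrow> complex) \<Rightarrow> complex \<Rightarrow> bool" where
  "tends_half f L \<longleftrightarrow> (\<lambda>n. f n - L) \<in> O(\<lambda>n. complex_of_real (real n powr (-1/2)))"

lemma tends_half_iff:
  "tends_half f L \<longleftrightarrow> (\<exists>C. \<forall>\<^sub>F n in sequentially. norm (f n - L) \<le> C * real n powr (-1/2))"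
  unfolding tends_half_def
proof
  assume "(\<lambda>n. f n - L) \<in> O(\<lambda>n. complex_of_real (real n powr (-1/2)))"
  then obtain C where "\<forall>\<^sub>F n in sequentially. norm (f n - L) \<le> C * norm (complex_of_real (real n powr (-1/2)))"
    by (rule landau_o.bigE)
  then show "\<exists>C. \<forall>\<^sub>F n in sequentially. norm (f n - L) \<le> C * real n powr (-1/2)"
    by auto
next
  assume "\<exists>C. \<forall>\<^sub>F n in sequentially. norm (f n - L) \<le> C * real n powr (-1/2)"
  then show "(\<lambda>n. f n - L) \<in> O(\<lambda>n. complex_of_real (real n powr (-1/2)))"
    by (auto intro: bigoI)
qed

lemma half_tendsto_0: "(\<lambda>n. real n powr (-1/2)) \<longlonglongrightarrow> 0"
  by real_asymp

lemma tends_half_LIMSEQ: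
  assumes "tends_half f L"
  shows "f \<longlonglongrightarrow> L"
proof -
  obtain C where C: "\<forall>\<^sub>F n in sequentially. norm (f n - L) \<le> C * real n powr (-1/2)"
    using assms by (auto simp: tends_half_iff)
  have "(\<lambda>n. C * real n powr (-1/2)) \<longlonglongrightarrow> 0"
    using tendsto_mult_right_zero[OF half_tendsto_0] by simp
  then have "(\<lambda>n. f n - L) \<longlonglongrightarrow> 0"
    using C by (rule Lim_null_comparison[rotated])
  then show ?thesis
    by (simp add: LIM_zero_iff)
qed

lemma tends_half_bounded:
  assumes "tends_half f L"
  shows "f \<in> O(\<lambda>_. 1)"
proof -
  have "((\<lambda>n. f n / 1) \<longlongrightarrow> L) sequentially"
    using tends_half_LIMSEQ[OF assms] by simp
  then show ?thesis
    by (intro bigoI_tendsto[of _ _ L]) auto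
qed

lemma tends_half_cong:
  assumes "\<forall>\<^sub>F n in sequentially. f n = g n"
  shows "tends_half f L \<longleftrightarrow> tends_half g L"
  unfolding tends_half_def
  by (intro landau_o.big.in_cong eventually_mono[OF assms]) auto

lemma tends_half_transform:
  assumes "tends_half f L" "\<forall>\<^sub>F n in sequentially. f n = g n"
  shows "tends_half g L"
  using assms(1) tends_half_cong[OF assms(2)] by simp

lemma tends_half_const [simp]: "tends_half (\<lambda>_. L) L"
  by (simp add: tends_half_def)

lemma tends_half_add:
  assumes "tends_half f L" "tends_half g M"
  shows "tends_half (\<lambda>n. f n + g n) (L + M)"
  using sum_in_bigo(1)[OF assms[unfolded tends_half_def]]
  by (simp add: tends_half_def algebra_simps)

lemma tends_half_mult:
  assumes f: "tends_half f L" and g: "tends_half g M"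
  shows "tends_half (\<lambda>n. f n * g n) (L * M)"
proof -
  let ?h = "\<lambda>n. complex_of_real (real n powr (-1/2))"
  have "(\<lambda>n. f n * (g n - M)) \<in> O(\<lambda>n. 1 * ?h n)"
    using tends_half_bounded[OF f] g unfolding tends_half_def by (rule landau_o.big.mult)
  moreover have "(\<lambda>n. M * (f n - L)) \<in> O(?h)"
    using f unfolding tends_half_def by simp
  ultimately have "(\<lambda>n. f n * (g n - M) + M * (f n - L)) \<in> O(?h)"
    by (intro sum_in_bigo) auto
  then show ?thesis
    by (simp add: tends_half_def algebra_simps)
qed

lemma tends_half_cmult: "tends_half f L \<Longrightarrow> tends_half (\<lambda>n. c * f n) (c * L)"
  by (rule tends_half_mult) auto

lemma tends_half_diff:
  assumes "tends_half f L" "tends_half g M"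
  shows "tends_half (\<lambda>n. f n - g n) (L - M)"
  using tends_half_add[OF assms(1) tends_half_cmult[OF assms(2), of "-1"]] by simp

lemma tends_half_nonzero:
  assumes "tends_half f L" "L \<noteq> 0"
  shows "\<forall>\<^sub>F n in sequentially. f n \<noteq> 0"
  using tends_half_LIMSEQ[OF assms(1)] assms(2) by (rule tendsto_imp_eventually_ne)

lemma tends_half_inverse:
  assumes f: "tends_half f L" and L: "L \<noteq> 0"
  shows "tends_half (\<lambda>n. inverse (f n)) (inverse L)"
proof -
  let ?h = "\<lambda>n. complex_of_real (real n powr (-1/2))"
  have "((\<lambda>n. inverse (f n) / 1) \<longlongrightarrow> inverse L) sequentially"
    using tendsto_inverse[OF tends_half_LIMSEQ[OF f] L] by simp
  then have "(\<lambda>n. inverse (f n)) \<in> O(\<lambda>_. 1)"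
    by (intro bigoI_tendsto[of _ _ "inverse L"]) auto
  then have "(\<lambda>n. inverse (f n) * (f n - L)) \<in> O(\<lambda>n. 1 * ?h n)"
    using f unfolding tends_half_def by (rule landau_o.big.mult)
  then have "(\<lambda>n. - inverse L * (inverse (f n) * (f n - L))) \<in> O(?h)"
    using L by simp
  moreover have "\<forall>\<^sub>F n in sequentially. - inverse L * (inverse (f n) * (f n - L)) = inverse (f n) - inverse L"
    using tends_half_nonzero[OF f L] by eventually_elim (simp add: L right_diff_distrib)
  ultimately show ?thesis
    unfolding tends_half_def
    using landau_o.big.in_cong[of "\<lambda>n. - inverse L * (inverse (f n) * (f n - L))"
        "\<lambda>n. inverse (f n) - inverse L" sequentially] by blast
qed

lemma tends_half_divide:
  assumes "tends_half f L" "tends_half g M" "M \<noteq> 0"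
  shows "tends_half (\<lambda>n. f n / g n) (L / M)"
  using tends_half_mult[OF assms(1) tends_half_inverse[OF assms(2,3)]]
  by (simp add: divide_inverse)

text \<open>The bound decreases in n, so an index map that never falls behind can only improve
  it.\<close>

lemma tends_half_subseq:
  assumes f: "tends_half f L" and g: "\<And>n. n \<le> g n"
  shows "tends_half (\<lambda>n. f (g n)) L"
proof -
  obtain C where C: "\<forall>\<^sub>F n in sequentially. norm (f n - L) \<le> C * real n powr (-1/2)"
    using f by (auto simp: tends_half_iff)
  have lim: "filterlim g at_top sequentially"
    using g by (intro filterlim_at_top_mono[OF filterlim_ident]) auto
  have "\<forall>\<^sub>F n in sequentially. norm (f (g n) - L) \<le> C * real (g n) powr (-1/2)"
    using filterlim_iff lim C by fast
  then have "\<forall>\<^sub>F n in sequentially. norm (f (g n) - L) \<le> \<bar>C\<bar> * real n powr (-1/2)"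
    using eventually_gt_at_top[of 0]
  proof eventually_elim
    case (elim n)
    have "C * real (g n) powr (-1/2) \<le> \<bar>C\<bar> * real (g n) powr (-1/2)"
      by (intro mult_right_mono) auto
    also have "\<dots> \<le> \<bar>C\<bar> * real n powr (-1/2)"
      using g[of n] elim(2) by (intro mult_left_mono powr_mono2') auto
    finally show ?case
      using elim by simp
  qed
  then show ?thesis
    unfolding tends_half_iff by blast
qed

lemma tends_half_even_odd:
  assumes even: "tends_half (\<lambda>m. f (2 * m)) L" and odd: "tends_half (\<lambda>m. f (2 * m + 1)) L"
  shows "tends_half f L"
proof -
  obtain C where "\<forall>\<^sub>F n in sequentially. norm (f (2 * n) - L) \<le> C * real n powr (-1/2)"
    using even by (auto simp: tends_half_iff)
  then obtain M where M: "\<And>n. n \<ge> M \<Longrightarrow> norm (f (2 * n) - L) \<le> C * real n powr (-1/2)"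
    by (auto simp: eventually_sequentially)
  obtain D where "\<forall>\<^sub>F n in sequentially. norm (f (2 * n + 1) - L) \<le> D * real n powr (-1/2)"
    using odd by (auto simp: tends_half_iff)
  then obtain N where N: "\<And>n. n \<ge> N \<Longrightarrow> norm (f (2 * n + 1) - L) \<le> D * real n powr (-1/2)"
    by (auto simp: eventually_sequentially)
  have "norm (f n - L) \<le> (\<bar>C\<bar> + \<bar>D\<bar>) * 2 * real n powr (-1/2)" if n: "n \<ge> 2 * M + 2 * N + 2" for n
  proof -
    have "n div 2 \<ge> M" "n div 2 \<ge> N"
      using n by auto
    moreover have "n = 2 * (n div 2) \<or> n = 2 * (n div 2) + 1"
      by presburger
    ultimately have "norm (f n - L) \<le> C * real (n div 2) powr (-1/2) \<or>
        norm (f n - L) \<le> D * real (n div 2) powr (-1/2)"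
      using M[of "n div 2"] N[of "n div 2"] by metis
    moreover have "C * real (n div 2) powr (-1/2) \<le> (\<bar>C\<bar> + \<bar>D\<bar>) * real (n div 2) powr (-1/2)"
      "D * real (n div 2) powr (-1/2) \<le> (\<bar>C\<bar> + \<bar>D\<bar>) * real (n div 2) powr (-1/2)"
      by (intro mult_right_mono; simp)+
    ultimately have "norm (f n - L) \<le> (\<bar>C\<bar> + \<bar>D\<bar>) * real (n div 2) powr (-1/2)"
      by linarith
    \<comment> \<open>n div 2 >= n / 4 holds from n = 2 on; a quarter is taken because its root
      gives the plain constant 2.\<close>
    also have "real (n div 2) powr (-1/2) \<le> (real n / 4) powr (-1/2)"
      using n by (intro powr_mono2') auto
    also have "(real n / 4) powr (-1/2) = 2 * real n powr (-1/2)"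
      by (simp add: powr_divide powr_minus powr_half_sqrt) (simp add: divide_inverse)
    finally show ?thesis
      by (simp only: mult.assoc mult_left_mono abs_ge_zero add_nonneg_nonneg)
  qed
  then show ?thesis
    unfolding tends_half_iff eventually_sequentially by blast
qed

lemma tends_half_I_nat:
  assumes "\<forall>\<^sub>F n in sequentially. norm (f n - L) \<le> C / real n"
  shows "tends_half f L"
proof -
  have "\<forall>\<^sub>F n in sequentially. norm (f n - L) \<le> \<bar>C\<bar> * real n powr (-1/2)"
    using assms eventually_ge_at_top[of 1]
  proof eventually_elim
    case (elim n)
    have "norm (f n - L) \<le> \<bar>C\<bar> * (1 / real n)"
      using elim divide_right_mono[of C "\<bar>C\<bar>" "real n"] abs_ge_self[of C] by simp
    also have "1 / real n = real n powr (-1)"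
      using elim by (simp add: powr_minus divide_inverse)
    also have "\<dots> \<le> real n powr (-1/2)"
      using elim by (intro powr_mono) auto
    finally show ?case
      by (simp add: mult_left_mono)
  qed
  then show ?thesis
    unfolding tends_half_iff by blast
qed

text \<open>Quotients 1 + O(1/n^2) make the increments O(1/n^2), and these are dominated by the
  telescoping 1/n - 1/(n+1); the tail is O(1/n). This supplies the rate for infinite products whose
  limit is already known: Wallis's product and the Gamma quotient.\<close>

lemma tends_half_of_ratio:
  fixes a :: "nat \<Rightarrow> complex"
  assumes lim: "a \<longlonglongrightarrow> L" and nz: "\<And>n. a n \<noteq> 0"
    and ratio: "\<forall>\<^sub>F n in sequentially. norm (a (Suc n) / a n - 1) \<le> C / (real n)\<^sup>2"
  shows "tends_half a L"
proof -
  obtain B where B: "\<And>n. norm (a n) \<le> B"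
    using convergent_imp_Bseq[of a] lim by (auto simp: convergent_def Bseq_def)
  obtain N where N: "\<And>n. n \<ge> N \<Longrightarrow> norm (a (Suc n) / a n - 1) \<le> C / (real n)\<^sup>2"
    using ratio by (auto simp: eventually_sequentially)
  define D where "D = 2 * B * \<bar>C\<bar>"
  have B0: "0 \<le> B" using B[of 0] norm_ge_zero order_trans by blast
  have step: "norm (a (Suc n) - a n) \<le> D / real n - D / real (Suc n)" if n: "n \<ge> N" "n > 0" for n
  proof -
    have "norm (a (Suc n) - a n) = norm (a n) * norm (a (Suc n) / a n - 1)"
      using nz[of n] by (simp add: norm_mult[symmetric] right_diff_distrib)
    also have "\<dots> \<le> B * (\<bar>C\<bar> / (real n)\<^sup>2)"
    proof (intro mult_mono B B0)
      have "C / (real n)\<^sup>2 \<le> \<bar>C\<bar> / (real n)\<^sup>2"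
        by (intro divide_right_mono) auto
      then show "norm (a (Suc n) / a n - 1) \<le> \<bar>C\<bar> / (real n)\<^sup>2"
        using N[OF n(1)] by linarith
    qed auto
    also have "\<dots> \<le> D * (1 / (real n * real (Suc n)))"
    proof -
      have "real n * real (Suc n) \<le> 2 * (real n)\<^sup>2"
        using n by (simp add: power2_eq_square algebra_simps)
      then have "1 / (real n)\<^sup>2 \<le> 2 / (real n * real (Suc n))"
        using n by (simp add: divide_simps del: of_nat_Suc)
      then have "B * \<bar>C\<bar> * (1 / (real n)\<^sup>2) \<le> B * \<bar>C\<bar> * (2 / (real n * real (Suc n)))"
        using B0 by (intro mult_left_mono) auto
      then show ?thesis
        by (simp add: D_def mult_ac)
    qed
    also have "\<dots> = D / real n - D / real (Suc n)"
      using n by (simp add: field_simps)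
    finally show ?thesis .
  qed
  have sumstep: "norm (a (n + k) - a n) \<le> D / real n - D / real (n + k)" if n: "n \<ge> N" "n > 0" for n k
  proof (induction k)
    case (Suc k)
    have "norm (a (n + Suc k) - a n) \<le> norm (a (Suc (n + k)) - a (n + k)) + norm (a (n + k) - a n)"
      using norm_triangle_ineq[of "a (Suc (n + k)) - a (n + k)" "a (n + k) - a n"] by simp
    then show ?case
      using Suc step[of "n + k"] n by (simp del: of_nat_Suc of_nat_add)
  qed auto
  have D0: "0 \<le> D" using B0 by (simp add: D_def)
  have "norm (a n - L) \<le> D / real n" if n: "n \<ge> N" "n > 0" for n
  proof -
    have "(\<lambda>k. norm (a (n + k) - a n)) \<longlonglongrightarrow> norm (L - a n)"
      using LIMSEQ_ignore_initial_segment[OF lim, of n]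
      by (intro tendsto_intros) (simp add: add.commute)
    moreover have "norm (a (n + k) - a n) \<le> D / real n" for k
      using sumstep[OF n, of k] divide_nonneg_nonneg[OF D0, of "real (n + k)"] by linarith
    ultimately have "norm (L - a n) \<le> D / real n"
      by (intro LIMSEQ_le_const2) auto
    then show ?thesis
      by (simp add: norm_minus_commute)
  qed
  then have "\<forall>\<^sub>F n in sequentially. norm (a n - L) \<le> D / real n"
    unfolding eventually_sequentially by (intro exI[of _ "max N 1"]) auto
  then show ?thesis
    by (rule tends_half_I_nat)
qed

section \<open>Perturbed contractions and sums dominated by their last term\<close>

lemma contraction_bound:
  fixes v :: "nat \<Rightarrow> real"
  assumes q: "0 \<le> q" "q < 1"
    and step: "\<forall>\<^sub>F n in sequentially. v (Suc n) \<le> q * v n + C * real n powr (-1/2)"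
  shows "\<exists>D. \<forall>\<^sub>F n in sequentially. v n \<le> D * real n powr (-1/2)"
proof -
  let ?h = "\<lambda>n. real n powr (-1/2)"
  define p where "p = (q + 1) / 2"
  have p: "q < p" "p < 1" "0 < p" using q by (auto simp: p_def)
  have "(\<lambda>n. real (Suc n) powr (-1/2) / real n powr (-1/2)) \<longlonglongrightarrow> 1"
    by real_asymp
  then have "\<forall>\<^sub>F n in sequentially. ?h (Suc n) / ?h n > p"
    using p(2) by (rule order_tendstoD)
  then have "\<forall>\<^sub>F n in sequentially. n > 0 \<and> ?h (Suc n) / ?h n > p \<and> v (Suc n) \<le> q * v n + C * ?h n"
    using step eventually_gt_at_top[of 0] by eventually_elim auto
  then obtain N where N: "\<And>n. n \<ge> N \<Longrightarrow> n > 0 \<and> ?h (Suc n) / ?h n > p \<and> v (Suc n) \<le> q * v n + C * ?h n"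
    by (auto simp: eventually_sequentially)
  \<comment> \<open>Since n^(-1/2) shrinks per step by a factor above p > q, a bound D n^(-1/2)
    reproduces itself as soon as q D + |C| <= p D. The first entry of the maximum starts the
    induction at N.\<close>
  define D where "D = max (v N / ?h N) (\<bar>C\<bar> / (p - q))"
  have D0: "\<bar>C\<bar> / (p - q) \<le> D" "D \<ge> 0"
    using p by (auto simp: D_def intro!: max.coboundedI2)
  have "v n \<le> D * ?h n" if "n \<ge> N" for n
    using that
  proof (induction n rule: dec_induct)
    case base
    have "v N = (v N / ?h N) * ?h N"
      using N[of N] by simp
    also have "\<dots> \<le> D * ?h N"
      by (intro mult_right_mono) (auto simp: D_def)
    finally show ?case .
  next
    case (step n)
    have h: "p * ?h n \<le> ?h (Suc n)"
      using N[OF step(1)] pos_less_divide_eq[of "?h n" p "?h (Suc n)"] by auto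
    have "v (Suc n) \<le> q * v n + C * ?h n"
      using N[OF step(1)] by simp
    also have "\<dots> \<le> q * (D * ?h n) + \<bar>C\<bar> * ?h n"
      using step(3) q by (intro add_mono mult_left_mono mult_right_mono) auto
    also have "\<dots> \<le> (q * D + (p - q) * D) * ?h n"
    proof -
      have "\<bar>C\<bar> \<le> (p - q) * D"
        using D0(1) p by (simp add: field_simps)
      then show ?thesis
        using mult_right_mono[of "\<bar>C\<bar>" "(p - q) * D" "?h n"] by (simp add: algebra_simps)
    qed
    also have "\<dots> = D * (p * ?h n)"
      by (simp add: algebra_simps)
    also have "\<dots> \<le> D * ?h (Suc n)"
      using h D0 by (intro mult_left_mono) auto
    finally show ?case .
  qed
  then show ?thesis
    unfolding eventually_sequentially by blast
qed

text \<open>Multiplied by T, the sum satisfies y' = r y + \<kappa> with r tending to w, whose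
  limiting fixed point is l = \<kappa> / (1 - w). The deviation v obeys v' = r v + l (r - w): a
  contraction, perturbed at exactly the rate at which the ratio converges.\<close>

lemma tends_half_stolz:
  fixes x T :: "nat \<Rightarrow> complex"
  assumes T: "\<forall>\<^sub>F n in sequentially. T n \<noteq> 0"
    and ratio: "tends_half (\<lambda>n. T (Suc n) / T n) w" and w: "norm w < 1"
    and step: "\<forall>\<^sub>F n in sequentially. x (Suc n) = x n + \<kappa> / T (Suc n)"
  shows "tends_half (\<lambda>n. x n * T n) (\<kappa> / (1 - w))"
proof -
  define r where "r = (\<lambda>n. T (Suc n) / T n)"
  define l where "l = \<kappa> / (1 - w)"
  define v where "v = (\<lambda>n. x n * T n - l)"
  define q where "q = (norm w + 1) / 2"
  have q: "0 \<le> q" "q < 1" "norm w < q"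
    using w by (simp_all add: q_def)
  have l: "\<kappa> = l * (1 - w)"
    using w by (auto simp: l_def)
  obtain C where C: "\<forall>\<^sub>F n in sequentially. norm (r n - w) \<le> C * real n powr (-1/2)"
    using ratio by (auto simp: tends_half_iff r_def)
  have "(\<lambda>n. norm (r n)) \<longlonglongrightarrow> norm w"
    using tends_half_LIMSEQ[OF ratio] by (auto simp: r_def intro: tendsto_norm)
  then have rq: "\<forall>\<^sub>F n in sequentially. norm (r n) < q"
    using q(3) by (rule order_tendstoD)
  have T': "\<forall>\<^sub>F n in sequentially. T (Suc n) \<noteq> 0"
    using T by (rule eventually_sequentially_Suc[of "\<lambda>n. T n \<noteq> 0", THEN iffD2])
  have "\<forall>\<^sub>F n in sequentially. norm (v (Suc n)) \<le> q * norm (v n) + (norm l * C) * real n powr (-1/2)"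
    using T T' step rq C
  proof eventually_elim
    case (elim n)
    have "v (Suc n) = r n * (x n * T n) + \<kappa> - l"
      using elim by (simp add: v_def r_def field_simps)
    also have "\<dots> = r n * v n + l * (r n - w)"
      by (simp add: v_def l algebra_simps)
    finally have "norm (v (Suc n)) \<le> norm (r n) * norm (v n) + norm l * norm (r n - w)"
      by (metis norm_triangle_ineq norm_mult)
    also have "\<dots> \<le> q * norm (v n) + norm l * (C * real n powr (-1/2))"
      using elim by (intro add_mono mult_right_mono mult_left_mono) auto
    finally show ?case by (simp add: mult.assoc)
  qed
  from contraction_bound[OF q(1,2) this] show ?thesis
    by (simp add: tends_half_iff v_def l_def)
qed


subsection \<open>Continuants\<close>

text \<open>The partial numerators involved in \<open>continuant R k j\<close> are \<open>R k, \<dots>, R (k + j - 2)\<close>.\<close>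

fun continuant :: "(nat \<Rightarrow> 'a :: comm_ring_1) \<Rightarrow> nat \<Rightarrow> nat \<Rightarrow> 'a" where
  "continuant R k 0 = 1"
| "continuant R k (Suc 0) = 1"
| "continuant R k (Suc (Suc j)) = continuant R (Suc k) (Suc j) + R k * continuant R (Suc (Suc k)) j"

text \<open>The definition expands at the first numerator, as \<open>cfrac\<close> does, while the
  recurrence in n that is shared with \<open>err\<close> expands at the last one. The two expansions
  act on opposite ends, so they commute in the induction.\<close>

lemma continuant_forward:
  "continuant R k (Suc (Suc j)) = continuant R k (Suc j) + R (k + j) * continuant R k j"
proof (induction j arbitrary: k rule: less_induct)
  case (less j)
  consider "j = 0" | "j = 1" | i where "j = Suc (Suc i)"
    by (metis One_nat_def not0_implies_Suc)
  then show ?case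
  proof cases
    case 3
    have "continuant R k (Suc (Suc j)) =
       (continuant R (Suc k) (Suc (Suc i)) + R (k + j) * continuant R (Suc k) (Suc i)) +
       R k * (continuant R (Suc (Suc k)) (Suc i) + R (k + j) * continuant R (Suc (Suc k)) i)"
      using less.IH[of "Suc i" "Suc k"] less.IH[of i "Suc (Suc k)"] 3 by simp
    also have "\<dots> = continuant R k (Suc j) + R (k + j) * continuant R k j"
      using 3 by (simp add: algebra_simps)
    finally show ?thesis .
  qed auto
qed

text \<open>The hypothesis lists the denominators of the inner levels only. If the outermost one
  vanishes, both sides are 0 by x / 0 = 0.\<close>

lemma cfrac_eq_continuant:
  assumes "\<And>i. i < j \<Longrightarrow> continuant R (k + 2 + i) (j - i) \<noteq> 0"
  shows "cfrac R k j = R k * continuant R (Suc (Suc k)) j / continuant R (Suc k) (Suc j)"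
  using assms
proof (induction j arbitrary: k)
  case (Suc j)
  have nz: "continuant R (Suc (Suc k)) (Suc j) \<noteq> 0"
    using Suc.prems[of 0] by simp
  have "cfrac R (Suc k) j = R (Suc k) * continuant R (Suc (Suc (Suc k))) j / continuant R (Suc (Suc k)) (Suc j)"
  proof (rule Suc.IH)
    fix i assume "i < j"
    then show "continuant R (Suc k + 2 + i) (j - i) \<noteq> 0"
      using Suc.prems[of "Suc i"] by simp
  qed
  then have "cfrac R k (Suc j) = R k / (1 + R (Suc k) * continuant R (Suc (Suc (Suc k))) j / continuant R (Suc (Suc k)) (Suc j))"
    by simp
  also have "\<dots> = R k * continuant R (Suc (Suc k)) (Suc j) / continuant R (Suc k) (Suc (Suc j))"
    using nz by (simp add: field_simps)
  finally show ?case .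
qed auto

text \<open>The easy half of the parabola theorem: the half-plane \<open>Re d \<ge> 1/2\<close> is invariant.\<close>

lemma parabola_step:
  fixes r d :: complex
  assumes r: "norm r - Re r \<le> 1/2" and d: "Re d \<ge> 1/2"
  shows "Re (1 + r / d) \<ge> 1/2"
proof -
  have d0: "d \<noteq> 0" using d by auto
  have "norm (1 / d - 1) \<le> 1"
  proof -
    have "(norm (1 - d))\<^sup>2 \<le> (norm d)\<^sup>2"
      using d unfolding cmod_power2 by (simp add: power2_eq_square algebra_simps)
    then have "norm (1 - d) \<le> norm d"
      by (rule power2_le_imp_le) simp
    moreover have "1 / d - 1 = (1 - d) / d"
      using d0 by (simp add: field_simps)
    ultimately show ?thesis
      using d0 by (simp add: norm_divide)
  qed
  then have "norm (r * (1 / d - 1)) \<le> norm r"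
    by (metis mult_left_le norm_ge_zero norm_mult)
  then have "Re (r * (1 / d - 1)) \<ge> - norm r"
    using complex_Re_le_cmod[of "- (r * (1 / d - 1))"] by simp
  moreover have "1 + r / d = 1 + r + r * (1 / d - 1)"
    by (simp add: algebra_simps)
  ultimately show ?thesis
    using r by (simp add: algebra_simps)
qed

text \<open>The quotients d_k satisfy d_k = 1 + R k / d_(k+1), the map of
  \<open>parabola_step\<close>, and start from 1. Nonvanishing is proved jointly: a zero continuant
  would make the quotient 0, against real part at least 1/2.\<close>

lemma continuant_ratio_Re:
  assumes R: "\<And>n. n \<ge> k0 \<Longrightarrow> norm (R n) - Re (R n) \<le> 1/2" and k: "k \<ge> k0"
  shows "continuant R k j \<noteq> 0 \<and> (j > 0 \<longrightarrow> Re (continuant R k j / continuant R (Suc k) (j - 1)) \<ge> 1/2)"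
  using k
proof (induction j arbitrary: k rule: less_induct)
  case (less j)
  consider "j = 0" | "j = 1" | i where "j = Suc (Suc i)"
    by (metis One_nat_def not0_implies_Suc)
  then show ?case
  proof cases
    case 3
    let ?d = "continuant R (Suc k) (Suc i) / continuant R (Suc (Suc k)) i"
    have nz: "continuant R (Suc k) (Suc i) \<noteq> 0" "continuant R (Suc (Suc k)) i \<noteq> 0"
      and d: "Re ?d \<ge> 1/2"
      using less.IH[of "Suc i" "Suc k"] less.IH[of i "Suc (Suc k)"] 3 less.prems by auto
    have "continuant R k j / continuant R (Suc k) (j - 1) = 1 + R k / ?d"
      using nz 3 by (simp add: field_simps)
    moreover have "Re (1 + R k / ?d) \<ge> 1/2"
      using R[OF less.prems] d by (rule parabola_step)
    ultimately show ?thesis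
      by (metis div_0 divide_eq_0_iff half_gt_zero_iff not_le zero_complex.sel(1) zero_less_one)
  qed auto
qed


subsection \<open>Minimal solutions of the recurrence\<close>

text \<open>What the continued fraction argument has to know about P, detached from hypergeometric
  functions. By the normalisation at index 0 the value of the infinite fraction is
  \<open>P 1\<close>. The sequence in \<open>ratio\<close> is the quotient of consecutive terms of
  \<open>main_term\<close> with the products of R cancelled.\<close>

locale minimal_solution =
  fixes R P :: "nat \<Rightarrow> complex" and w :: complex
  assumes R_0: "R 0 = 1" and P_0: "P 0 = 1"
    and P_rec: "\<And>n. P n = P (Suc n) + R (Suc n) * P (Suc (Suc n))"
    and R_nonzero: "\<And>n. R (Suc n) \<noteq> 0"
    and P_nonzero: "\<forall>\<^sub>F n in sequentially. P n \<noteq> 0"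
    and ratio: "tends_half (\<lambda>n. - R (Suc (Suc n)) * P (Suc (Suc (Suc n))) / P (Suc n)) w"
    and norm_w: "norm w < 1"
    and parabola: "\<forall>\<^sub>F n in sequentially. norm (R n) - Re (R n) \<le> 1/2"
begin

definition prodR :: "nat \<Rightarrow> complex" where "prodR n = (\<Prod>i<n. R (Suc i))"

definition err :: "nat \<Rightarrow> complex" where
  "err n = (-1) ^ Suc n * prodR (Suc n) * P (Suc (Suc n))"

definition main_term :: "nat \<Rightarrow> complex" where
  "main_term n = (-1) ^ Suc n * prodR (Suc n) * P (Suc n) * P (Suc (Suc n))"

lemma prodR_Suc: "prodR (Suc n) = R (Suc n) * prodR n"
  by (simp add: prodR_def)

lemma prodR_nonzero: "prodR n \<noteq> 0"
  using R_nonzero by (simp add: prodR_def)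

lemma err_rec: "err (Suc (Suc n)) = err (Suc n) + R (Suc (Suc n)) * err n"
proof -
  have "P (Suc (Suc n)) = P (Suc (Suc (Suc n))) + R (Suc (Suc (Suc n))) * P (Suc (Suc (Suc (Suc n))))"
    by (rule P_rec)
  then show ?thesis
    unfolding err_def prodR_Suc[of "Suc (Suc n)"] prodR_Suc[of "Suc n"]
    by (simp add: algebra_simps)
qed

text \<open>Both sides solve the recurrence \<open>err_rec\<close> and agree at n = 0 and n = 1. As
  R 0 = 1, the two continuants are denominator and numerator of the n-th truncation, so
  \<open>err\<close> over the denominator is the truncation error.\<close>

lemma err_eq: "err n = P 1 * continuant R 1 (Suc n) - continuant R 2 n"
proof (induction n rule: less_induct)
  case (less n)
  consider "n = 0" | "n = 1" | i where "n = Suc (Suc i)"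
    by (metis One_nat_def not0_implies_Suc)
  then show ?case
  proof cases
    case 1
    then show ?thesis
      using P_rec[of 0] by (simp add: err_def prodR_def P_0 algebra_simps numeral_2_eq_2)
  next
    case 2
    have "P 0 = P 1 + R 1 * P 2" "P 1 = P 2 + R 2 * P 3"
      using P_rec[of 0] P_rec[of 1] by (simp_all add: numeral_2_eq_2 numeral_3_eq_3)
    moreover have "err 1 = R 1 * R 2 * P 3"
      by (simp add: err_def prodR_def numeral_2_eq_2 numeral_3_eq_3)
    moreover have "continuant R 1 2 = 1 + R 1"
      by (simp add: numeral_2_eq_2)
    moreover have "P 1 * (1 + R 1) - (P 1 + R 1 * P 2) = R 1 * (P 1 - P 2)"
      by (simp add: algebra_simps)
    ultimately show ?thesis
      using P_0 2 by (simp add: numeral_2_eq_2)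
  next
    case 3
    have IH: "err (Suc i) = P 1 * continuant R 1 (Suc (Suc i)) - continuant R 2 (Suc i)"
      "err i = P 1 * continuant R 1 (Suc i) - continuant R 2 i"
      using less.IH 3 by auto
    have fw: "continuant R 1 (Suc n) = continuant R 1 (Suc (Suc i)) + R (Suc (Suc i)) * continuant R 1 (Suc i)"
      "continuant R 2 n = continuant R 2 (Suc i) + R (Suc (Suc i)) * continuant R 2 i"
      using continuant_forward[of R 1 "Suc i"] continuant_forward[of R 2 i] 3 by simp_all
    have "err n = err (Suc i) + R (Suc (Suc i)) * err i"
      using 3 err_rec by simp
    also have "\<dots> = P 1 * continuant R 1 (Suc n) - continuant R 2 n"
      unfolding IH fw by (simp only: algebra_simps)
    finally show ?thesis .
  qed
qed

lemma main_term_nonzero: "\<forall>\<^sub>F n in sequentially. main_term n \<noteq> 0"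
proof -
  have "\<forall>\<^sub>F n in sequentially. P (Suc n) \<noteq> 0"
    using P_nonzero by (rule eventually_sequentially_Suc[of "\<lambda>n. P n \<noteq> 0", THEN iffD2])
  moreover from this have "\<forall>\<^sub>F n in sequentially. P (Suc (Suc n)) \<noteq> 0"
    by (rule eventually_sequentially_Suc[of "\<lambda>n. P (Suc n) \<noteq> 0", THEN iffD2])
  ultimately show ?thesis
    by eventually_elim (simp add: main_term_def prodR_nonzero)
qed

lemma main_term_ratio: "tends_half (\<lambda>n. main_term (Suc n) / main_term n) w"
proof -
  have "\<forall>\<^sub>F n in sequentially. main_term (Suc n) / main_term n =
      - R (Suc (Suc n)) * P (Suc (Suc (Suc n))) / P (Suc n)"
    using main_term_nonzero
  proof eventually_elim
    case (elim n)
    then show ?case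
      unfolding main_term_def prodR_Suc[of "Suc n"] by (simp add: field_simps)
  qed
  from tends_half_cong[OF this] ratio show ?thesis
    by simp
qed

text \<open>\<open>U k j\<close> is the denominator of \<open>cfrac R k j\<close>. Besides k = 0,
  which gives the truncations, all k are treated because the zeros of the tails have to be excluded
  too. In n = k + j both \<open>U k\<close> and \<open>err\<close> solve one recurrence;
  \<open>\<kappa> k\<close> is their Casoratian, freed of sign and \<open>prodR\<close>.\<close>

lemma continuant_over_err:
  defines "U \<equiv> \<lambda>k j. continuant R (Suc k) (Suc j)"
  defines "\<kappa> \<equiv> \<lambda>k. (-1) ^ k * (err (Suc k) * U k 0 - err k * U k 1) / prodR (Suc k)"
  shows continuant_over_err_step:
      "\<forall>\<^sub>F j in sequentially. U k (Suc j) / err (k + Suc j) = U k j / err (k + j) + \<kappa> k / main_term (k + Suc j)"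
    and continuant_over_err_tends:
      "tends_half (\<lambda>j. U k j / err (k + j) * main_term (k + j)) (\<kappa> k / (1 - w))"
proof -
  have U_rec: "U k (Suc (Suc j)) = U k (Suc j) + R (Suc (Suc (k + j))) * U k j" for j
    using continuant_forward[of R "Suc k" "Suc j"] by (simp add: U_def)
  have G_rec: "err (k + Suc (Suc j)) = err (k + Suc j) + R (Suc (Suc (k + j))) * err (k + j)" for j
    using err_rec[of "k + j"] by simp
  \<comment> \<open>Each step of the recurrence multiplies the Casoratian by -R (n + 2), hence it is
    a constant times a sign times \<open>prodR\<close>; the constant is read off at j = 0.\<close>
  have cas: "err (k + Suc j) * U k j - err (k + j) * U k (Suc j) = (-1) ^ (k + j) * \<kappa> k * prodR (Suc (k + j))" for j
  proof (induction j)
    case 0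
    show ?case
      by (simp add: \<kappa>_def prodR_nonzero power_mult_distrib[symmetric] mult.assoc[symmetric])
  next
    case (Suc j)
    have "err (k + Suc (Suc j)) * U k (Suc j) - err (k + Suc j) * U k (Suc (Suc j)) =
        - R (Suc (Suc (k + j))) * (err (k + Suc j) * U k j - err (k + j) * U k (Suc j))"
      unfolding U_rec G_rec by (simp add: algebra_simps)
    also have "\<dots> = (-1) ^ (k + Suc j) * \<kappa> k * prodR (Suc (k + Suc j))"
      unfolding Suc.IH using prodR_Suc[of "Suc (k + j)"] by simp
    finally show ?case .
  qed
  have "\<forall>\<^sub>F n in sequentially. main_term n \<noteq> 0 \<and> main_term (Suc n) \<noteq> 0"
    using main_term_nonzero eventually_sequentially_Suc[of "\<lambda>n. main_term n \<noteq> 0"]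
    by (intro eventually_conj) auto
  then have "\<forall>\<^sub>F j in sequentially. main_term (j + k) \<noteq> 0 \<and> main_term (Suc (j + k)) \<noteq> 0"
    by (rule eventually_sequentially_seg[of _ k, THEN iffD2])
  then show step: "\<forall>\<^sub>F j in sequentially. U k (Suc j) / err (k + Suc j) = U k j / err (k + j) + \<kappa> k / main_term (k + Suc j)"
  proof eventually_elim
    case (elim j)
    define n where "n = k + j"
    have m: "main_term n \<noteq> 0" "main_term (Suc n) \<noteq> 0"
      using elim by (simp_all add: n_def add.commute)
    then have nz: "P (Suc n) \<noteq> 0" "P (Suc (Suc n)) \<noteq> 0" "P (Suc (Suc (Suc n))) \<noteq> 0"
        "err n \<noteq> 0" "err (Suc n) \<noteq> 0"
      by (auto simp: main_term_def err_def)
    have "U k (Suc j) / err (Suc n) - U k j / err n =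
        - (err (Suc n) * U k j - err n * U k (Suc j)) / (err n * err (Suc n))"
      using nz by (simp add: field_simps)
    also have "\<dots> = - ((-1) ^ n * \<kappa> k * prodR (Suc n)) / (err n * err (Suc n))"
      using cas[of j] by (simp add: n_def)
    also have "\<dots> = \<kappa> k / main_term (Suc n)"
      using nz prodR_nonzero[of "Suc n"] prodR_nonzero[of "Suc (Suc n)"]
      unfolding err_def main_term_def
      by (cases "even n") (simp_all add: field_simps)
    finally show ?case
      by (simp add: n_def algebra_simps)
  qed
  have seg: "\<forall>\<^sub>F j in sequentially. main_term (k + j) \<noteq> 0"
    using eventually_sequentially_seg[of "\<lambda>n. main_term n \<noteq> 0" k, THEN iffD2, OF main_term_nonzero]
    by (simp add: add.commute)
  have "tends_half (\<lambda>j. main_term (k + Suc j) / main_term (k + j)) w"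
    using tends_half_subseq[OF main_term_ratio, of "\<lambda>j. k + j"] by simp
  from tends_half_stolz[OF seg this norm_w step]
  show "tends_half (\<lambda>j. U k j / err (k + j) * main_term (k + j)) (\<kappa> k / (1 - w))" .
qed

text \<open>\<open>\<kappa> = 0\<close> happens precisely when \<open>P k = 0\<close>; the continuant is then a multiple of the minimal
  solution \<open>err\<close>, which is itself eventually nonzero.\<close>

lemma continuant_eventually_nonzero:
  "\<forall>\<^sub>F j in sequentially. continuant R (Suc k) (Suc j) \<noteq> 0"
proof -
  define U where "U = (\<lambda>j. continuant R (Suc k) (Suc j))"
  define \<kappa> where "\<kappa> = (-1) ^ k * (err (Suc k) * U 0 - err k * U 1) / prodR (Suc k)"
  have step: "\<forall>\<^sub>F j in sequentially. U (Suc j) / err (k + Suc j) = U j / err (k + j) + \<kappa> / main_term (k + Suc j)"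
    unfolding U_def \<kappa>_def by (rule continuant_over_err_step)
  have tends: "tends_half (\<lambda>j. U j / err (k + j) * main_term (k + j)) (\<kappa> / (1 - w))"
    unfolding U_def \<kappa>_def by (rule continuant_over_err_tends)
  show ?thesis
  proof (cases "\<kappa> = 0")
    case False
    have "\<kappa> / (1 - w) \<noteq> 0"
      using False norm_w by auto
    from tends_half_nonzero[OF tends this] show ?thesis
      by eventually_elim (auto simp: U_def)
  next
    case True
    have "\<forall>\<^sub>F n in sequentially. main_term (n + k) \<noteq> 0"
      by (rule eventually_sequentially_seg[of "\<lambda>n. main_term n \<noteq> 0" k, THEN iffD2, OF main_term_nonzero])
    then have "\<forall>\<^sub>F j in sequentially. err (k + j) \<noteq> 0 \<and> U (Suc j) / err (k + Suc j) = U j / err (k + j)"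
      using step by eventually_elim (auto simp: True main_term_def err_def add.commute)
    then obtain N where N: "\<And>j. j \<ge> N \<Longrightarrow> err (k + j) \<noteq> 0 \<and> U (Suc j) / err (k + Suc j) = U j / err (k + j)"
      by (auto simp: eventually_sequentially)
    have const: "U j / err (k + j) = U N / err (k + N)" if "j \<ge> N" for j
      using that
    proof (induction j rule: dec_induct)
      case (step n)
      then show ?case using N[of n] by simp
    qed auto
    have U_rec: "U (Suc (Suc j)) = U (Suc j) + R (Suc (Suc (k + j))) * U j" for j
      using continuant_forward[of R "Suc k" "Suc j"] by (simp add: U_def)
    \<comment> \<open>The quotient is constant from N on, so a zero at N would spread to all later
      indices. Since R does not vanish, the recurrence can then be run backwards down to U 0 =
      1.\<close>
    have "U N \<noteq> 0"
    proof
      assume 0: "U N = 0"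
      have fw: "U j = 0" if "j \<ge> N" for j
        using const[OF that] N[OF that] 0 by auto
      have bw: "U j = 0" if "U (Suc j) = 0" "U (Suc (Suc j)) = 0" for j
        using U_rec[of j] that R_nonzero by simp
      have "U j = 0 \<and> U (Suc j) = 0" if "j \<le> N" for j
        using that by (induction j rule: inc_induct) (auto intro: fw bw)
      from this[of 0] show False
        by (simp add: U_def)
    qed
    then have "U j \<noteq> 0" if "j \<ge> N" for j
      using const[OF that] N[of N] N[OF that] by auto
    then show ?thesis
      unfolding U_def eventually_sequentially by blast
  qed
qed

text \<open>The tails starting far out stay in an invariant half-plane; each of the finitely many others
  is handled by its own asymptotics. This excludes the junk value \<open>x / 0 = 0\<close> in the truncations.\<close>

lemma denominators_nonzero:
  "\<forall>\<^sub>F n in sequentially. \<forall>i\<le>n. continuant R (Suc i) (Suc n - i) \<noteq> 0"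
proof -
  obtain k0 where k0: "\<And>n. n \<ge> k0 \<Longrightarrow> norm (R n) - Re (R n) \<le> 1/2"
    using parabola by (auto simp: eventually_sequentially)
  have "\<forall>\<^sub>F n in sequentially. \<forall>i\<in>{..<k0}. continuant R (Suc i) (Suc (n - i)) \<noteq> 0"
  proof (rule eventually_ball_finite)
    show "\<forall>i\<in>{..<k0}. \<forall>\<^sub>F n in sequentially. continuant R (Suc i) (Suc (n - i)) \<noteq> 0"
    proof
      fix i
      show "\<forall>\<^sub>F n in sequentially. continuant R (Suc i) (Suc (n - i)) \<noteq> 0"
        using eventually_sequentially_seg[of "\<lambda>n. continuant R (Suc i) (Suc (n - i)) \<noteq> 0" i]
          continuant_eventually_nonzero[of i] by simp
    qed
  qed auto
  then show ?thesis
  proof eventually_elim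
    case (elim n)
    show ?case
    proof (intro allI impI)
      fix i assume "i \<le> n"
      show "continuant R (Suc i) (Suc n - i) \<noteq> 0"
      proof (cases "i < k0")
        case True
        then show ?thesis using elim \<open>i \<le> n\<close> by (simp add: Suc_diff_le)
      next
        case False
        then show ?thesis
          using continuant_ratio_Re[of k0 R "Suc i"] k0 by simp
      qed
    qed
  qed
qed

theorem truncation_error:
  "tends_half (\<lambda>n. (P 1 - cfrac R 0 n) / main_term n) (1 - w)"
proof -
  define U where "U = (\<lambda>j. continuant R 1 (Suc j))"
  \<comment> \<open>The initial Casoratian is R 1 = \<open>prodR 1\<close>, so the constant in
    \<open>continuant_over_err_tends\<close> at k = 0 equals 1. The limit there becomes 1 / (1 - w),
    and its inverse is the claim.\<close>
  have \<kappa>: "err 1 * U 0 - err 0 * U 1 = R 1"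
  proof -
    have "P 0 = P 1 + R 1 * P 2" "P 1 = P 2 + R 2 * P 3"
      using P_rec[of 0] P_rec[of 1] by (simp_all add: numeral_2_eq_2 numeral_3_eq_3)
    then show ?thesis
      using P_0 by (simp add: U_def err_def prodR_def numeral_2_eq_2 numeral_3_eq_3) algebra
  qed
  have "tends_half (\<lambda>n. U n / err n * main_term n) (1 / (1 - w))"
    using continuant_over_err_tends[of 0] \<kappa> R_nonzero[of 0]
    by (simp add: U_def prodR_def)
  then have lim: "tends_half (\<lambda>n. inverse (U n / err n * main_term n)) (1 - w)"
    using tends_half_inverse[of _ "1 / (1 - w)"] norm_w by fastforce
  have "\<forall>\<^sub>F n in sequentially. inverse (U n / err n * main_term n) = (P 1 - cfrac R 0 n) / main_term n"
    using denominators_nonzero main_term_nonzero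
  proof eventually_elim
    case (elim n)
    have nz: "continuant R 1 (Suc n) \<noteq> 0"
      using elim(1) by auto
    have "cfrac R 0 n = R 0 * continuant R (Suc (Suc 0)) n / continuant R (Suc 0) (Suc n)"
    proof (rule cfrac_eq_continuant)
      fix i assume "i < n"
      then show "continuant R (0 + 2 + i) (n - i) \<noteq> 0"
        using elim(1)[rule_format, of "Suc i"] by simp
    qed
    then have "P 1 - cfrac R 0 n = err n / U n"
      using nz by (simp add: err_eq R_0 U_def field_simps numeral_2_eq_2)
    moreover have "err n \<noteq> 0"
      using elim(2) by (auto simp: err_def main_term_def)
    ultimately show ?case
      using elim(2) by (simp add: field_simps)
  qed
  from tends_half_cong[OF this] lim show ?thesis
    by simp
qed

end


subsection \<open>Laplace's method\<close>

text \<open>Costs only a constant, as n - k >= n / 4 for n >= 2 k + 1. It removes the offset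
  \<open>M\<close> from which on the Euler integrals are available.\<close>

lemma tends_half_unshift:
  assumes "tends_half (\<lambda>n. f (n + k)) L"
  shows "tends_half f L"
proof -
  obtain C where "\<forall>\<^sub>F n in sequentially. norm (f (n + k) - L) \<le> C * real n powr (-1/2)"
    using assms by (auto simp: tends_half_iff)
  then obtain N where N: "\<And>n. n \<ge> N \<Longrightarrow> norm (f (n + k) - L) \<le> C * real n powr (-1/2)"
    by (auto simp: eventually_sequentially)
  have "norm (f n - L) \<le> \<bar>C\<bar> * 2 * real n powr (-1/2)" if n: "n \<ge> N + 2 * k + 1" for n
  proof -
    have "norm (f n - L) \<le> C * real (n - k) powr (-1/2)"
      using N[of "n - k"] n by simp
    also have "\<dots> \<le> \<bar>C\<bar> * real (n - k) powr (-1/2)"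
      by (intro mult_right_mono) auto
    also have "real (n - k) powr (-1/2) \<le> (real n / 4) powr (-1/2)"
      using n by (intro powr_mono2') (auto simp: of_nat_diff)
    also have "(real n / 4) powr (-1/2) = 2 * real n powr (-1/2)"
      by (simp add: powr_divide powr_minus powr_half_sqrt) (simp add: divide_inverse)
    finally show ?thesis
      by (simp only: mult.assoc mult_left_mono abs_ge_zero)
  qed
  then show ?thesis
    unfolding tends_half_iff eventually_sequentially by blast
qed

text \<open>Near t0 the derivative gives the bound; at distance d or more, boundedness does. A
  derivative is asked for at t0 alone because the integrands to come are merely continuous at the
  end point 1.\<close>

lemma norm_le_linear:
  fixes h :: "real \<Rightarrow> complex"
  assumes cont: "continuous_on {a..b} h" and deriv: "(h has_vector_derivative h') (at t0)" and h0: "h t0 = 0"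
  shows "\<exists>C. \<forall>t\<in>{a..b}. norm (h t) \<le> C * \<bar>t - t0\<bar>"
proof -
  obtain d where d: "d > 0" "\<And>t. \<bar>t - t0\<bar> < d \<Longrightarrow> norm (h t - h t0 - (t - t0) *\<^sub>R h') \<le> 1 * \<bar>t - t0\<bar>"
    using deriv unfolding has_vector_derivative_def has_derivative_at_alt
    by (metis zero_less_one real_norm_def)
  obtain B where B: "\<And>t. t \<in> {a..b} \<Longrightarrow> norm (h t) \<le> B"
    using compact_imp_bounded[OF compact_continuous_image[OF cont compact_Icc]]
    unfolding bounded_iff by blast
  have "norm (h t) \<le> max (1 + norm h') (B / d) * \<bar>t - t0\<bar>" if t: "t \<in> {a..b}" for t
  proof (cases "\<bar>t - t0\<bar> < d")
    case True
    have "norm (h t) \<le> norm (h t - (t - t0) *\<^sub>R h') + norm ((t - t0) *\<^sub>R h')"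
      by (metis diff_add_cancel norm_triangle_ineq)
    also have "\<dots> \<le> (1 + norm h') * \<bar>t - t0\<bar>"
      using d(2)[OF True] by (simp only: norm_scaleR real_norm_def h0 distrib_right mult_1 diff_0_right mult.commute[of _ "norm h'"])
    also have "\<dots> \<le> max (1 + norm h') (B / d) * \<bar>t - t0\<bar>"
      by (intro mult_right_mono) auto
    finally show ?thesis .
  next
    case False
    have B0: "0 \<le> B" using B[OF t] norm_ge_zero order_trans by blast
    have "norm (h t) \<le> B / d * d"
      using B[OF t] d(1) by simp
    also have "\<dots> \<le> B / d * \<bar>t - t0\<bar>"
      using False d(1) B0 by (intro mult_left_mono) auto
    also have "\<dots> \<le> max (1 + norm h') (B / d) * \<bar>t - t0\<bar>"
      by (intro mult_right_mono) auto
    finally show ?thesis .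
  qed
  then show ?thesis by blast
qed

text \<open>s stands for sqrt (1 - z): the condition z < 1 becomes s > 0, and the saddle point and
  the limits of all ratios become rational in s.\<close>

locale laplace =
  fixes s :: real
  assumes s: "s > 0"
begin

definition z :: real where "z = 1 - s\<^sup>2"
text \<open>The maximum of the kernel t (1 - t) / (1 - z t) on [0, 1], that is, the root of 1 - 2 t
  + z t^2 in this interval.\<close>

definition t0 :: real where "t0 = 1 / (1 + s)"
definition u :: "real \<Rightarrow> real" where "u t = (1 - (1 + s) * t) / sqrt (1 - z * t)"
text \<open>\<open>v\<close> is the derivative of \<open>- u\<close>, see \<open>u_deriv\<close>.\<close>

definition v :: "real \<Rightarrow> real" where
  "v t = (1 + s)\<^sup>2 / 2 * (1 - (1 - s) * t) / ((1 - z * t) * sqrt (1 - z * t))"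

text \<open>1 - z t is the convex combination of 1 and s^2 with weights 1 - t and t.\<close>

lemma pos: "1 - z * t > 0" if "t \<in> {0..1}"
proof -
  have eq: "1 - z * t = (1 - t) + s\<^sup>2 * t" by (simp add: z_def algebra_simps)
  show ?thesis
  proof (cases "t = 0")
    case False
    then have "s\<^sup>2 * t > 0" using s that by auto
    then show ?thesis using that unfolding eq by auto
  qed auto
qed

lemma pos': "1 - (1 - s) * t > 0" if "t \<in> {0..1}"
proof (cases "t = 0")
  case False
  then have "s * t > 0" using s that by auto
  then show ?thesis using that by (simp add: algebra_simps)
qed auto

lemma t0: "t0 \<in> {0<..<1}"
  using s by (auto simp: t0_def)

lemma one_minus_u_sq:
  assumes t: "t \<in> {0..1}"
  shows "1 - (u t)\<^sup>2 = (1 + s)\<^sup>2 * (t * (1 - t) / (1 - z * t))"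
proof -
  have "(u t)\<^sup>2 = (1 - (1 + s) * t)\<^sup>2 / (1 - z * t)"
    using pos[OF t] by (simp add: u_def power_divide)
  then have "1 - (u t)\<^sup>2 = ((1 - z * t) - (1 - (1 + s) * t)\<^sup>2) / (1 - z * t)"
    using pos[OF t] by (simp add: field_simps)
  also have "(1 - z * t) - (1 - (1 + s) * t)\<^sup>2 = (1 + s)\<^sup>2 * (t * (1 - t))"
    by (simp add: z_def power2_eq_square algebra_simps)
  finally show ?thesis by simp
qed

lemma u_sq_le: "t \<in> {0..1} \<Longrightarrow> 0 \<le> 1 - (u t)\<^sup>2"
  using one_minus_u_sq[of t] pos[of t] by simp

lemma v_pos: "t \<in> {0..1} \<Longrightarrow> v t > 0"
  using pos[of t] pos'[of t] s by (simp add: v_def)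

lemma u_deriv:
  assumes t: "t \<in> {0..1}"
  shows "(u has_real_derivative - v t) (at t)"
proof -
  define r where "r = sqrt (1 - z * t)"
  have p: "1 - z * t > 0" by (rule pos[OF t])
  have r: "r > 0" "1 - z * t = r\<^sup>2" using p by (simp_all add: r_def)
  have "(u has_real_derivative (- (1 + s) * r - (1 - (1 + s) * t) * (- z * (inverse r / 2))) / (r * r)) (at t)"
    unfolding u_def r_def
    by (rule derivative_eq_intros refl p | use p in simp)+
  also have "(- (1 + s) * r - (1 - (1 + s) * t) * (- z * (inverse r / 2))) / (r * r) =
      (- (1 + s) * r\<^sup>2 + (1 - (1 + s) * t) * z / 2) / (r\<^sup>2 * r)"
    using r(1) by (simp add: field_simps power2_eq_square)
  also have "- (1 + s) * r\<^sup>2 + (1 - (1 + s) * t) * z / 2 = - ((1 + s)\<^sup>2 / 2 * (1 - (1 - s) * t))"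
    unfolding r(2)[symmetric] by (simp add: z_def power2_eq_square field_simps)
  also have "- ((1 + s)\<^sup>2 / 2 * (1 - (1 - s) * t)) / (r\<^sup>2 * r) = - v t"
    using p by (simp add: v_def r_def)
  finally show ?thesis .
qed

lemma u_cont: "continuous_on {0..1} u"
  by (rule DERIV_continuous_on[OF has_field_derivative_at_within[OF u_deriv]])

lemma v_deriv:
  assumes "t \<in> {0..1}"
  shows "\<exists>d. (v has_real_derivative d) (at t)"
  unfolding v_def using pos[OF assms]
  by - (rule exI, (rule derivative_eq_intros refl | simp)+)

lemma v_cont: "continuous_on {0..1} v"
proof (intro continuous_at_imp_continuous_on ballI)
  fix t :: real assume "t \<in> {0..1}"
  from v_deriv[OF this] show "isCont v t"
    by (auto dest: DERIV_isCont)
qed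

lemma u_0: "u 0 = 1"
  by (simp add: u_def)

lemma u_1: "u 1 = - 1"
  using s by (simp add: u_def z_def)

lemma u_t0: "u t0 = 0"
  using s by (simp add: u_def t0_def)

text \<open>The Wallis integral of (1 - u^2)^m over [-1, 1], pulled back to t. It stays in this
  form, so the substitution enters only through the derivative of u.\<close>

definition \<beta> :: "nat \<Rightarrow> real" where
  "\<beta> m = integral {0..1} (\<lambda>t. (1 - (u t)\<^sup>2) ^ m * v t)"

lemma \<beta>_integrable: "(\<lambda>t. (1 - (u t)\<^sup>2) ^ m * v t) integrable_on {0..1}"
  by (intro integrable_continuous_real continuous_intros u_cont v_cont)

lemma \<beta>_0: "\<beta> 0 = 2"
proof -
  have "((\<lambda>t. - u t) has_vector_derivative v t) (at t within {0..1})" if "t \<in> {0..1}" for t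
    using has_field_derivative_at_within[OF DERIV_minus[OF u_deriv[OF that]]]
    by (simp add: has_real_derivative_iff_has_vector_derivative)
  then have "(v has_integral (- u 1 - (- u 0))) {0..1}"
    by (intro fundamental_theorem_of_calculus) auto
  then show ?thesis
    by (simp add: \<beta>_def u_0 u_1 integral_unique)
qed

text \<open>The derivative of u (1 - u^2)^(m+1) in u is (2m+3) (1 - u^2)^(m+1) - (2m+2) (1 - u^2)^m,
  and the function vanishes at both end points u = 1 and u = -1.\<close>

lemma \<beta>_Suc: "(2 * real m + 3) * \<beta> (Suc m) = (2 * real m + 2) * \<beta> m"
proof -
  let ?F = "\<lambda>t. - (u t * (1 - (u t)\<^sup>2) ^ Suc m)"
  have "(?F has_vector_derivative
        (2 * real m + 3) * ((1 - (u t)\<^sup>2) ^ Suc m * v t) - (2 * real m + 2) * ((1 - (u t)\<^sup>2) ^ m * v t)) (at t within {0..1})"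
    if t: "t \<in> {0..1}" for t
  proof -
    note [derivative_intros] = u_deriv[OF t]
    have "(?F has_real_derivative
        - (- v t * (1 - (u t)\<^sup>2) ^ Suc m + (real (Suc m) * (1 - (u t)\<^sup>2) ^ m * (2 * u t * v t)) * u t)) (at t)"
      by (rule derivative_eq_intros refl | simp)+
    also have "- (- v t * (1 - (u t)\<^sup>2) ^ Suc m + (real (Suc m) * (1 - (u t)\<^sup>2) ^ m * (2 * u t * v t)) * u t) =
       (2 * real m + 3) * ((1 - (u t)\<^sup>2) ^ Suc m * v t) - (2 * real m + 2) * ((1 - (u t)\<^sup>2) ^ m * v t)"
      by (simp add: algebra_simps power2_eq_square)
    finally show ?thesis
      by (simp add: has_real_derivative_iff_has_vector_derivative has_vector_derivative_at_within)
  qed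
  then have "((\<lambda>t. (2 * real m + 3) * ((1 - (u t)\<^sup>2) ^ Suc m * v t) - (2 * real m + 2) * ((1 - (u t)\<^sup>2) ^ m * v t))
      has_integral (?F 1 - ?F 0)) {0..1}"
    by (intro fundamental_theorem_of_calculus) auto
  moreover have "((\<lambda>t. (2 * real m + 3) * ((1 - (u t)\<^sup>2) ^ Suc m * v t) - (2 * real m + 2) * ((1 - (u t)\<^sup>2) ^ m * v t))
      has_integral ((2 * real m + 3) * \<beta> (Suc m) - (2 * real m + 2) * \<beta> m)) {0..1}"
    unfolding \<beta>_def
    by (intro has_integral_diff has_integral_mult_right integrable_integral \<beta>_integrable)
  ultimately have "?F 1 - ?F 0 = (2 * real m + 3) * \<beta> (Suc m) - (2 * real m + 2) * \<beta> m"
    by (rule has_integral_unique)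
  then show ?thesis
    by (simp add: u_0 u_1)
qed

text \<open>The first absolute moment, found exactly by splitting at t0, where u changes sign. Its
  order 1/m against the order m^(-1/2) of \<open>\<beta> m\<close> is the origin of the error
  n^(-1/2).\<close>

lemma abs_u_integral:
  "((\<lambda>t. (1 - (u t)\<^sup>2) ^ m * (\<bar>u t\<bar> * v t)) has_integral (1 / (real m + 1))) {0..1}"
proof -
  let ?F = "\<lambda>t. (1 - (u t)\<^sup>2) ^ Suc m / (2 * (real m + 1))"
  have F: "(?F has_real_derivative (1 - (u t)\<^sup>2) ^ m * (u t * v t)) (at t)"
    if t: "t \<in> {0..1}" for t
  proof -
    note [derivative_intros] = u_deriv[OF t]
    have "(?F has_real_derivative (real (Suc m) * (1 - (u t)\<^sup>2) ^ m * (2 * u t * v t)) / (2 * (real m + 1))) (at t)"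
      by (rule derivative_eq_intros refl | simp)+
    also have "(real (Suc m) * (1 - (u t)\<^sup>2) ^ m * (2 * u t * v t)) / (2 * (real m + 1)) = (1 - (u t)\<^sup>2) ^ m * (u t * v t)"
      by (simp add: field_simps)
    finally show ?thesis .
  qed
  have sgn: "u t \<ge> 0" if "t \<in> {0..t0}" for t
  proof -
    have "(1 + s) * t \<le> (1 + s) * t0" using that s by (intro mult_left_mono) auto
    also have "\<dots> = 1" using s by (simp add: t0_def)
    finally show ?thesis using pos[of t] that t0 by (auto simp: u_def)
  qed
  have sgn': "u t \<le> 0" if "t \<in> {t0..1}" for t
  proof -
    have "1 = (1 + s) * t0" using s by (simp add: t0_def)
    also have "\<dots> \<le> (1 + s) * t" using that s by (intro mult_left_mono) auto
    finally show ?thesis using pos[of t] that t0 by (auto simp: u_def divide_le_0_iff)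
  qed
  have "((\<lambda>t. (1 - (u t)\<^sup>2) ^ m * (\<bar>u t\<bar> * v t)) has_integral (?F t0 - ?F 0)) {0..t0}"
  proof (rule fundamental_theorem_of_calculus)
    fix t assume "t \<in> {0..t0}"
    then have "t \<in> {0..1}" and u: "\<bar>u t\<bar> = u t"
      using t0 sgn by auto
    from F[OF this(1)] show "(?F has_vector_derivative (1 - (u t)\<^sup>2) ^ m * (\<bar>u t\<bar> * v t)) (at t within {0..t0})"
      unfolding u has_real_derivative_iff_has_vector_derivative by (rule has_vector_derivative_at_within)
  qed (use t0 in auto)
  moreover have "((\<lambda>t. (1 - (u t)\<^sup>2) ^ m * (\<bar>u t\<bar> * v t)) has_integral (- ?F 1 - (- ?F t0))) {t0..1}"
  proof (rule fundamental_theorem_of_calculus)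
    fix t assume "t \<in> {t0..1}"
    then have "t \<in> {0..1}" and u: "\<bar>u t\<bar> = - u t"
      using t0 sgn' by auto
    from DERIV_minus[OF F[OF this(1)]]
    have "((\<lambda>t. - ?F t) has_real_derivative (1 - (u t)\<^sup>2) ^ m * (\<bar>u t\<bar> * v t)) (at t)"
      unfolding u by simp
    then show "((\<lambda>t. - ?F t) has_vector_derivative (1 - (u t)\<^sup>2) ^ m * (\<bar>u t\<bar> * v t)) (at t within {t0..1})"
      unfolding has_real_derivative_iff_has_vector_derivative by (rule has_vector_derivative_at_within)
  qed (use t0 in auto)
  ultimately have "((\<lambda>t. (1 - (u t)\<^sup>2) ^ m * (\<bar>u t\<bar> * v t)) has_integral (?F t0 - ?F 0) + (- ?F 1 - (- ?F t0))) {0..1}"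
    using t0 by (intro has_integral_combine[of 0 t0 1]) auto
  moreover have "(?F t0 - ?F 0) + (- ?F 1 - (- ?F t0)) = 1 / (real m + 1)"
    by (simp add: u_0 u_1 u_t0 divide_simps)
  ultimately show ?thesis
    by simp
qed


lemma \<beta>_wallis: "(2 * real m + 1) * (\<beta> m)\<^sup>2 = 4 * (\<Prod>k=1..m. (4 * real k^2) / (4 * real k^2 - 1))"
proof (induction m)
  case 0
  show ?case by (simp add: \<beta>_0)
next
  case (Suc m)
  have "\<beta> (Suc m) = (2 * real m + 2) / (2 * real m + 3) * \<beta> m"
    using \<beta>_Suc[of m] by (simp add: field_simps)
  then have "(2 * real (Suc m) + 1) * (\<beta> (Suc m))\<^sup>2 =
      (2 * real m + 3) * ((2 * real m + 2)\<^sup>2 / (2 * real m + 3)\<^sup>2) * (\<beta> m)\<^sup>2"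
    by (simp only: power_mult_distrib power_divide) simp
  also have "(2 * real m + 3) * ((2 * real m + 2)\<^sup>2 / (2 * real m + 3)\<^sup>2) = (2 * real m + 2)\<^sup>2 / (2 * real m + 3)"
    by (simp add: power2_eq_square)
  also have "(2 * real m + 2)\<^sup>2 / (2 * real m + 3) =
      (4 * real (Suc m)^2) / (4 * real (Suc m)^2 - 1) * (2 * real m + 1)"
  proof -
    have "4 * real (Suc m)^2 - 1 = (2 * real m + 1) * (2 * real m + 3)"
      by (simp add: power2_eq_square algebra_simps)
    moreover have "(2 * real m + 2)\<^sup>2 = 4 * real (Suc m)^2"
      by (simp add: power2_eq_square algebra_simps)
    ultimately show ?thesis
      by (simp add: divide_simps)
  qed
  finally have "(2 * real (Suc m) + 1) * (\<beta> (Suc m))\<^sup>2 =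
      (4 * real (Suc m)^2) / (4 * real (Suc m)^2 - 1) * ((2 * real m + 1) * (\<beta> m)\<^sup>2)"
    by (simp only: mult.assoc)
  then show ?case
    unfolding Suc.IH by simp
qed

text \<open>Squaring turns \<open>\<beta>\<close> into four times Wallis's product, with limit 4 *
  pi / 2. The factors are 1 + O(1/k^2), so \<open>tends_half_of_ratio\<close> adds the rate. The
  square is harmless since \<open>main_term\<close> contains two Euler integrals.\<close>

lemma \<beta>_sq_tends: "tends_half (\<lambda>m. of_real ((2 * real m + 1) * (\<beta> m)\<^sup>2)) (of_real (2 * pi))"
proof -
  define W where "W = (\<lambda>m. \<Prod>k=1..m. (4 * real k^2) / (4 * real k^2 - 1))"
  have fac: "4 * real k^2 - 1 > 0" if "k \<ge> 1" for k
  proof -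
    have "1 \<le> real k ^ 2" using that by simp
    then show ?thesis by linarith
  qed
  have W0: "W m > 0" for m
    unfolding W_def using fac by (intro prod_pos) (auto intro!: divide_pos_pos)
  have ratio: "W (Suc m) / W m = 1 + 1 / (4 * real (Suc m)^2 - 1)" for m
  proof -
    have "W (Suc m) = W m * ((4 * real (Suc m)^2) / (4 * real (Suc m)^2 - 1))"
      by (simp add: W_def)
    then show ?thesis
      using W0[of m] fac[of "Suc m"] by (simp add: divide_simps del: of_nat_Suc)
  qed
  have "tends_half (\<lambda>m. complex_of_real (W m)) (of_real (pi / 2))"
  proof (rule tends_half_of_ratio)
    show "(\<lambda>m. complex_of_real (W m)) \<longlonglongrightarrow> of_real (pi / 2)"
      unfolding W_def by (intro tendsto_of_real wallis)
    show "complex_of_real (W n) \<noteq> 0" for n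
      using W0[of n] by simp
    have "norm (complex_of_real (W (Suc n)) / complex_of_real (W n) - 1) \<le> 1 / (real n)\<^sup>2" if "n > 0" for n
    proof -
      have "complex_of_real (W (Suc n)) / complex_of_real (W n) - 1 = of_real (1 / (4 * real (Suc n)^2 - 1))"
        using ratio[of n] by (simp flip: of_real_divide add: of_real_add del: of_nat_Suc)
      then have "norm (complex_of_real (W (Suc n)) / complex_of_real (W n) - 1) = 1 / (4 * real (Suc n)^2 - 1)"
        using fac[of "Suc n"] by (simp only: norm_of_real) simp
      also have "\<dots> \<le> 1 / (real n)\<^sup>2"
      proof (rule divide_left_mono)
        show "(real n)\<^sup>2 \<le> 4 * real (Suc n)^2 - 1"
          by (simp add: power2_eq_square algebra_simps)
        show "0 < (4 * real (Suc n)^2 - 1) * (real n)\<^sup>2"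
          using that fac[of "Suc n"] by (intro mult_pos_pos) auto
      qed simp
      finally show ?thesis .
    qed
    then show "\<forall>\<^sub>F n in sequentially. norm (complex_of_real (W (Suc n)) / complex_of_real (W n) - 1) \<le> 1 / (real n)\<^sup>2"
      using eventually_gt_at_top[of 0] by (rule eventually_mono[rotated]) auto
  qed
  from tends_half_cmult[OF this, of 4] show ?thesis
    by (simp add: \<beta>_wallis W_def)
qed

lemma \<beta>_pos: "\<beta> m > 0"
proof (induction m)
  case (Suc m)
  then have "(2 * real m + 3) * \<beta> (Suc m) > 0"
    unfolding \<beta>_Suc by (intro mult_pos_pos) auto
  then show ?case
    by (auto simp: zero_less_mult_iff)
qed (simp add: \<beta>_0)

text \<open>All factors of Wallis's product are at least 1. The bound is explicit because
  \<open>\<beta> m\<close> is the denominator in the error estimate of Laplace's method.\<close>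

lemma \<beta>_lower: "2 / sqrt (2 * real m + 1) \<le> \<beta> m"
proof (rule power2_le_imp_le)
  have "1 \<le> (\<Prod>k=1..m. (4 * real k^2) / (4 * real k^2 - 1))"
  proof (rule prod_ge_1)
    fix k assume "k \<in> {1..m}"
    then have "1 \<le> real k ^ 2" by simp
    then show "1 \<le> 4 * real k ^ 2 / (4 * real k ^ 2 - 1)"
      by (simp add: le_divide_eq)
  qed
  then have "4 \<le> (2 * real m + 1) * (\<beta> m)\<^sup>2"
    unfolding \<beta>_wallis by simp
  then show "(2 / sqrt (2 * real m + 1))\<^sup>2 \<le> (\<beta> m)\<^sup>2"
    by (simp add: power_divide divide_le_eq mult.commute)
qed (use \<beta>_pos[of m] in simp)

definition J :: "(real \<Rightarrow> complex) \<Rightarrow> nat \<Rightarrow> complex" where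
  "J g m = integral {0..1} (\<lambda>t. of_real ((t * (1 - t) / (1 - z * t)) ^ m) * g t)"

lemma v_t0: "v t0 = (1 + s) / sqrt s"
proof -
  have "1 - z * t0 = s" "1 - (1 - s) * t0 = 2 * s / (1 + s)"
    using s by (simp_all add: z_def t0_def field_simps power2_eq_square)
  then have "v t0 = (1 + s)\<^sup>2 / 2 * (2 * s / (1 + s)) / (s * sqrt s)"
    by (simp only: v_def)
  then show ?thesis
    using s by (simp add: power2_eq_square)
qed

text \<open>u is linear in t - t0 up to the factor (1 + s) / sqrt (1 - z t), so the quotient of the
  two sides is a positive continuous function on a compact interval. This trades |t - t0| for the
  weight whose integral is known exactly.\<close>

lemma abs_diff_t0_le: "\<exists>K. \<forall>t\<in>{0..1}. \<bar>t - t0\<bar> \<le> K * (\<bar>u t\<bar> * v t)"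
proof -
  define q where "q = (\<lambda>t. (1 + s) / sqrt (1 - z * t) * v t)"
  have "continuous_on {0..1} q"
    unfolding q_def using pos by (intro continuous_intros v_cont) (auto simp: less_le)
  then obtain a where a: "a \<in> {0..1}" "\<And>t. t \<in> {0..1} \<Longrightarrow> q a \<le> q t"
    using continuous_attains_inf[of "{0..1::real}" q] by auto
  have qa: "q a > 0"
    using a(1) pos[of a] v_pos[of a] s by (simp add: q_def)
  have "\<bar>t - t0\<bar> \<le> 1 / q a * (\<bar>u t\<bar> * v t)" if t: "t \<in> {0..1}" for t
  proof -
    have "1 - (1 + s) * t = (1 + s) * (t0 - t)"
      using s by (simp add: t0_def field_simps)
    then have "\<bar>u t\<bar> * v t = q t * \<bar>t - t0\<bar>"
      using pos[OF t] s by (simp add: u_def q_def abs_mult abs_minus_commute)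
    moreover have "q a * \<bar>t - t0\<bar> \<le> q t * \<bar>t - t0\<bar>"
      using a(2)[OF t] by (intro mult_right_mono) auto
    ultimately show ?thesis
      using qa by (simp add: field_simps)
  qed
  then show ?thesis by blast
qed

text \<open>A multiple of v is subtracted from g so that the difference h vanishes at t0. The
  multiple integrates exactly to a multiple of \<open>\<beta> m\<close>; the remainder is at most a
  constant times |u| v, whose integral against the kernel is O(1/m).\<close>

theorem laplace_tends:
  assumes g: "continuous_on {0..1} g" and g': "(g has_vector_derivative g') (at t0)"
  shows "tends_half (\<lambda>m. of_real ((1 + s) ^ (2 * m) / \<beta> m) * J g m) (g t0 * of_real (sqrt s / (1 + s)))"
proof -
  \<comment> \<open>This is g t0 / v t0, by \<open>v_t0\<close>.\<close>
  define k where "k = g t0 * of_real (sqrt s / (1 + s))"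
  define h where "h = (\<lambda>t. g t - k * of_real (v t))"
  have t0': "t0 \<in> {0..1}" using t0 by auto
  obtain d where "(v has_real_derivative d) (at t0)"
    using v_deriv[OF t0'] by blast
  then have "(h has_vector_derivative g' - k * of_real d) (at t0)"
    unfolding h_def
    by (intro has_vector_derivative_diff g' has_vector_derivative_mult_right has_vector_derivative_of_real)
  moreover have h_cont: "continuous_on {0..1} h"
    unfolding h_def by (intro continuous_intros g v_cont)
  moreover have "h t0 = 0"
  proof -
    have "k * of_real (v t0) = g t0 * of_real (sqrt s / (1 + s) * v t0)"
      by (simp only: k_def of_real_mult mult.assoc)
    also have "sqrt s / (1 + s) * v t0 = 1"
      using s by (simp add: v_t0)
    finally show ?thesis by (simp add: h_def)
  qed
  ultimately obtain C where C: "\<And>t. t \<in> {0..1} \<Longrightarrow> norm (h t) \<le> C * \<bar>t - t0\<bar>"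
    using norm_le_linear[of 0 1 h] by blast
  obtain K where K: "\<And>t. t \<in> {0..1} \<Longrightarrow> \<bar>t - t0\<bar> \<le> K * (\<bar>u t\<bar> * v t)"
    using abs_diff_t0_le by blast
  define B where "B = \<bar>C\<bar> * K"
  have hB: "norm (h t) \<le> B * (\<bar>u t\<bar> * v t)" if t: "t \<in> {0..1}" for t
  proof -
    have "norm (h t) \<le> \<bar>C\<bar> * \<bar>t - t0\<bar>"
      using C[OF t] mult_right_mono[OF abs_ge_self[of C] abs_ge_zero[of "t - t0"]] by linarith
    also have "\<dots> \<le> \<bar>C\<bar> * (K * (\<bar>u t\<bar> * v t))"
      using K[OF t] by (intro mult_left_mono) auto
    finally show ?thesis by (simp add: B_def mult.assoc)
  qed
  have J_eq: "of_real ((1 + s) ^ (2 * m)) * J g m = integral {0..1} (\<lambda>t. of_real ((1 - (u t)\<^sup>2) ^ m) * h t) + k * of_real (\<beta> m)" for m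
  proof -
    have "of_real ((1 + s) ^ (2 * m)) * J g m =
        integral {0..1} (\<lambda>t. of_real ((1 + s) ^ (2 * m)) * (of_real ((t * (1 - t) / (1 - z * t)) ^ m) * g t))"
      unfolding J_def by (rule integral_mult_right[symmetric])
    also have "\<dots> = integral {0..1} (\<lambda>t. of_real ((1 - (u t)\<^sup>2) ^ m) * h t + k * of_real ((1 - (u t)\<^sup>2) ^ m * v t))"
    proof (rule integral_cong)
      fix t :: real assume t: "t \<in> {0..1}"
      have "(1 - (u t)\<^sup>2) ^ m = (1 + s) ^ (2 * m) * (t * (1 - t) / (1 - z * t)) ^ m"
        unfolding one_minus_u_sq[OF t] by (simp only: power_mult_distrib power_mult)
      then have "of_real ((1 + s) ^ (2 * m)) * (of_real ((t * (1 - t) / (1 - z * t)) ^ m) * g t) = of_real ((1 - (u t)\<^sup>2) ^ m) * g t"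
        by (simp add: mult.assoc)
      then show "of_real ((1 + s) ^ (2 * m)) * (of_real ((t * (1 - t) / (1 - z * t)) ^ m) * g t) =
          of_real ((1 - (u t)\<^sup>2) ^ m) * h t + k * of_real ((1 - (u t)\<^sup>2) ^ m * v t)"
        by (simp add: h_def algebra_simps)
    qed
    also have "\<dots> = integral {0..1} (\<lambda>t. of_real ((1 - (u t)\<^sup>2) ^ m) * h t) + integral {0..1} (\<lambda>t. k * of_real ((1 - (u t)\<^sup>2) ^ m * v t))"
      by (intro integral_add integrable_continuous_real continuous_intros u_cont v_cont h_cont)
    also have "integral {0..1} (\<lambda>t. k * of_real ((1 - (u t)\<^sup>2) ^ m * v t)) = k * of_real (\<beta> m)"
    proof -
      have "((\<lambda>t. complex_of_real ((1 - (u t)\<^sup>2) ^ m * v t)) has_integral of_real (\<beta> m)) {0..1}"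
        unfolding \<beta>_def by (intro has_integral_of_real integrable_integral \<beta>_integrable)
      from has_integral_mult_right[OF this, of k] show ?thesis
        by (rule integral_unique)
    qed
    finally show ?thesis .
  qed
  have bound: "norm (integral {0..1} (\<lambda>t. of_real ((1 - (u t)\<^sup>2) ^ m) * h t)) \<le> B / (real m + 1)" for m
  proof -
    have "norm (integral {0..1} (\<lambda>t. of_real ((1 - (u t)\<^sup>2) ^ m) * h t)) \<le>
        integral {0..1} (\<lambda>t. B * ((1 - (u t)\<^sup>2) ^ m * (\<bar>u t\<bar> * v t)))"
    proof (rule integral_norm_bound_integral)
      fix t :: real assume t: "t \<in> {0..1}"
      have "norm (of_real ((1 - (u t)\<^sup>2) ^ m) * h t) = (1 - (u t)\<^sup>2) ^ m * norm (h t)"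
        unfolding norm_mult norm_of_real using u_sq_le[OF t] by simp
      also have "\<dots> \<le> (1 - (u t)\<^sup>2) ^ m * (B * (\<bar>u t\<bar> * v t))"
        using hB[OF t] u_sq_le[OF t] by (intro mult_left_mono) auto
      finally show "norm (of_real ((1 - (u t)\<^sup>2) ^ m) * h t) \<le> B * ((1 - (u t)\<^sup>2) ^ m * (\<bar>u t\<bar> * v t))"
        by (simp add: mult_ac)
    qed (intro integrable_continuous_real continuous_intros u_cont v_cont h_cont)+
    also have "\<dots> = B * (1 / (real m + 1))"
      using has_integral_mult_right[OF abs_u_integral, of B m] by (rule integral_unique)
    finally show ?thesis by simp
  qed
  have B0: "B \<ge> 0"
    using order_trans[OF norm_ge_zero bound[of 0]] by simp
  have "norm (of_real ((1 + s) ^ (2 * m) / \<beta> m) * J g m - k) \<le> B * real m powr (-1/2)" if m: "m > 0" for m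
  proof -
    have "of_real ((1 + s) ^ (2 * m) / \<beta> m) * J g m - k =
        (of_real ((1 + s) ^ (2 * m)) * J g m - k * of_real (\<beta> m)) / of_real (\<beta> m)"
      using \<beta>_pos[of m] by (simp add: field_simps)
    also have "\<dots> = integral {0..1} (\<lambda>t. of_real ((1 - (u t)\<^sup>2) ^ m) * h t) / of_real (\<beta> m)"
      unfolding J_eq by simp
    also have "norm \<dots> = norm (integral {0..1} (\<lambda>t. of_real ((1 - (u t)\<^sup>2) ^ m) * h t)) / \<beta> m"
      using \<beta>_pos[of m] by (simp add: norm_divide)
    also have "\<dots> \<le> (B / (real m + 1)) / (2 / sqrt (2 * real m + 1))"
      using bound[of m] \<beta>_lower[of m] B0 by (intro frac_le) auto
    also have "\<dots> = B * (sqrt (2 * real m + 1) / (2 * (real m + 1)))"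
      by simp
    also have "\<dots> \<le> B * (1 / sqrt (real m))"
    proof (intro mult_left_mono B0)
      have "sqrt (2 * real m + 1) * sqrt (real m) \<le> sqrt ((2 * (real m + 1))\<^sup>2)"
        unfolding real_sqrt_mult[symmetric]
        by (intro real_sqrt_le_mono) (simp add: power2_eq_square algebra_simps)
      then have "sqrt (2 * real m + 1) * sqrt (real m) \<le> 2 * (real m + 1)"
        by simp
      then show "sqrt (2 * real m + 1) / (2 * (real m + 1)) \<le> 1 / sqrt (real m)"
        using m by (simp add: field_simps)
    qed
    also have "1 / sqrt (real m) = real m powr (-1/2)"
      using m by (simp add: powr_minus powr_half_sqrt) (simp add: divide_inverse)
    finally show ?thesis .
  qed
  then show ?thesis
    unfolding tends_half_iff k_def[symmetric] eventually_sequentially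
    by (intro exI[of _ B] exI[of _ 1]) auto
qed

end


subsection \<open>Euler integrals\<close>

text \<open>Integration by parts lowers j and raises \<beta> by 1. The primitives are continuous on
  [0, 1], but for Re \<beta> < 1 the integrand at j = 0 blows up at t = 1; hence the fundamental
  theorem is used with derivatives in the interior only.\<close>

lemma Beta_integral_nat:
  assumes "Re \<beta> > 0"
  shows "((\<lambda>t. of_real t ^ j * of_real (1 - t) powr (\<beta> - 1)) has_integral
    (fact j / pochhammer \<beta> (Suc j) :: complex)) {0..1}"
  using assms
proof (induction j arbitrary: \<beta>)
  have powr_cont: "continuous_on {0..1} (\<lambda>t. complex_of_real (1 - t) powr \<beta>)" if "Re \<beta> > 0" for \<beta>
    using that by (intro continuous_on_powr_complex continuous_intros) auto
  have nonpos: "1 - complex_of_real t \<notin> \<real>\<^sub>\<le>\<^sub>0" if "t < 1" for t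
    using that by (auto simp: complex_nonpos_Reals_iff)
  {
    case (0 \<beta>)
    then have \<beta>: "\<beta> \<noteq> 0" by auto
    have "((\<lambda>t. of_real (1 - t) powr (\<beta> - 1)) has_integral
        (- (of_real (1 - 1) powr \<beta> / \<beta>) - (- (of_real (1 - 0) powr \<beta> / \<beta>)))) {0..1::real}"
    proof (rule fundamental_theorem_of_calculus_interior)
      show "continuous_on {0..1} (\<lambda>t. - (complex_of_real (1 - t) powr \<beta> / \<beta>))"
        using 0 \<beta> by (intro continuous_intros powr_cont) auto
      fix t :: real assume "t \<in> {0<..<1}"
      then have "((\<lambda>x. - ((1 - x) powr \<beta> / \<beta>)) has_field_derivative (1 - of_real t) powr (\<beta> - 1)) (at (of_real t))"
        using \<beta> nonpos[of t] by (auto intro!: derivative_eq_intros)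
      from has_vector_derivative_real_field[OF this]
      show "((\<lambda>t. - (of_real (1 - t) powr \<beta> / \<beta>)) has_vector_derivative of_real (1 - t) powr (\<beta> - 1)) (at t)"
        by simp
    qed auto
    then show ?case
      by simp
  next
    case (Suc j \<beta>)
    then have \<beta>: "\<beta> \<noteq> 0" by auto
    have A: "((\<lambda>t. of_nat (Suc j) * (of_real t ^ j * of_real (1 - t) powr \<beta>) - \<beta> * (of_real t ^ Suc j * of_real (1 - t) powr (\<beta> - 1)))
        has_integral (of_real 1 ^ Suc j * of_real (1 - 1) powr \<beta> - of_real 0 ^ Suc j * of_real (1 - 0) powr \<beta>)) {0..1::real}"
    proof (rule fundamental_theorem_of_calculus_interior)
      show "continuous_on {0..1} (\<lambda>t. complex_of_real t ^ Suc j * complex_of_real (1 - t) powr \<beta>)"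
        using Suc.prems by (intro continuous_intros powr_cont) auto
      fix t :: real assume "t \<in> {0<..<1}"
      then have d2: "((\<lambda>x. (1 - x) powr \<beta>) has_field_derivative - (\<beta> * (1 - of_real t) powr (\<beta> - 1))) (at (of_real t))"
        using nonpos[of t] by (auto intro!: derivative_eq_intros)
      have d1: "((\<lambda>x. x ^ Suc j) has_field_derivative of_nat (Suc j) * of_real t ^ j) (at (complex_of_real t))"
        by (rule DERIV_cong[OF DERIV_power[OF DERIV_ident]]) simp
      have "((\<lambda>x. x ^ Suc j * (1 - x) powr \<beta>) has_field_derivative
          of_nat (Suc j) * (of_real t ^ j * (1 - of_real t) powr \<beta>) - \<beta> * (of_real t ^ Suc j * (1 - of_real t) powr (\<beta> - 1))) (at (of_real t))"
        using DERIV_mult[OF d1 d2] by (simp add: algebra_simps)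
      from has_vector_derivative_real_field[OF this]
      show "((\<lambda>t. of_real t ^ Suc j * of_real (1 - t) powr \<beta>) has_vector_derivative
         of_nat (Suc j) * (of_real t ^ j * of_real (1 - t) powr \<beta>) - \<beta> * (of_real t ^ Suc j * of_real (1 - t) powr (\<beta> - 1))) (at t)"
        by simp
    qed auto
    have B: "((\<lambda>t. of_nat (Suc j) * (of_real t ^ j * of_real (1 - t) powr \<beta>)) has_integral
        of_nat (Suc j) * (fact j / pochhammer (\<beta> + 1) (Suc j))) {0..1}"
      using Suc.IH[of "\<beta> + 1"] Suc.prems by (intro has_integral_mult_right) simp
    have "((\<lambda>t. of_nat (Suc j) * (of_real t ^ j * of_real (1 - t) powr \<beta>) -
        (of_nat (Suc j) * (of_real t ^ j * of_real (1 - t) powr \<beta>) - \<beta> * (of_real t ^ Suc j * of_real (1 - t) powr (\<beta> - 1))))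
        has_integral (of_nat (Suc j) * (fact j / pochhammer (\<beta> + 1) (Suc j)) -
          (of_real 1 ^ Suc j * of_real (1 - 1) powr \<beta> - of_real 0 ^ Suc j * of_real (1 - 0) powr \<beta>))) {0..1::real}"
      by (rule has_integral_diff[OF B A])
    then have "((\<lambda>t. \<beta> * (of_real t ^ Suc j * of_real (1 - t) powr (\<beta> - 1))) has_integral
        of_nat (Suc j) * (fact j / pochhammer (\<beta> + 1) (Suc j))) {0..1::real}"
      by simp
    from has_integral_mult_right[OF this, of "inverse \<beta>"]
    have "((\<lambda>t. of_real t ^ Suc j * of_real (1 - t) powr (\<beta> - 1)) has_integral
        inverse \<beta> * (of_nat (Suc j) * (fact j / pochhammer (\<beta> + 1) (Suc j)))) {0..1::real}"
      using \<beta> by (simp add: mult.assoc[symmetric])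
    also have "inverse \<beta> * (of_nat (Suc j) * (fact j / pochhammer (\<beta> + 1) (Suc j))) = fact (Suc j) / pochhammer \<beta> (Suc (Suc j))"
      unfolding pochhammer_rec[of \<beta> "Suc j"] by (simp add: divide_inverse mult_ac)
    finally show ?case .
  }
qed

text \<open>Euler's integral for F(j + 1, \<gamma>; \<beta> + j + 1; u) without its Beta factor.
  With a natural exponent of t, integrability at the end points depends on \<beta> alone, and
  \<gamma> stays arbitrary.\<close>

definition Euler_integral :: "complex \<Rightarrow> complex \<Rightarrow> nat \<Rightarrow> complex \<Rightarrow> complex" where
  "Euler_integral \<beta> \<gamma> j u =
     integral {0..1} (\<lambda>t. of_real t ^ j * of_real (1 - t) powr (\<beta> - 1) * (1 - u * of_real t) powr (- \<gamma>))"

lemma binomial_series: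
  fixes x \<gamma> :: complex
  assumes "norm x < 1"
  shows "(\<lambda>k. pochhammer \<gamma> k / fact k * x ^ k) sums (1 - x) powr (- \<gamma>)"
proof -
  have "(\<lambda>k. ((- \<gamma>) gchoose k) * (- x) ^ k) sums (1 + (- x)) powr (- \<gamma>)"
    using assms by (intro gen_binomial_complex) simp
  moreover have "((- \<gamma>) gchoose k) * (- x) ^ k = pochhammer \<gamma> k / fact k * x ^ k" for k
  proof -
    have "(- x) ^ k = (- 1) ^ k * x ^ k"
      by (metis mult_minus1 power_mult_distrib)
    then show ?thesis
      by (simp add: gbinomial_pochhammer power_mult_distrib[symmetric] mult.assoc[symmetric])
  qed
  ultimately show ?thesis by simp
qed

lemma binomial_series_abs_summable:
  fixes x \<gamma> :: complex
  assumes "norm x < 1"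
  shows "summable (\<lambda>k. norm (pochhammer \<gamma> k / fact k * x ^ k))"
proof -
  define y where "y = complex_of_real ((norm x + 1) / 2)"
  have y: "norm y < 1" "norm x < norm y"
    using assms norm_ge_zero[of x] unfolding y_def norm_of_real by simp_all
  have "summable (\<lambda>k. pochhammer \<gamma> k / fact k * y ^ k)"
    using binomial_series[OF y(1)] by (rule sums_summable)
  from powser_insidea[OF this y(2)] show ?thesis .
qed

text \<open>Re \<beta> > 1 makes (1 - t)^(\<beta> - 1) continuous and bounded on [0, 1]. The
  binomial series in u t then converges uniformly in t, and its terms integrate to Beta
  integrals.\<close>

lemma Euler_integral_sums:
  assumes \<beta>: "Re \<beta> > 1" and u: "norm u < 1"
  shows "(\<lambda>k. pochhammer \<gamma> k / fact k * u ^ k * (fact (j + k) / pochhammer \<beta> (Suc (j + k)))) sums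
    Euler_integral \<beta> \<gamma> j u"
proof -
  define g where "g = (\<lambda>t. complex_of_real (1 - t) powr (\<beta> - 1))"
  define f where "f = (\<lambda>k t. pochhammer \<gamma> k / fact k * u ^ k * (of_real t ^ (j + k) * g t))"
  have g_cont: "continuous_on {0..1} g"
    unfolding g_def using \<beta> by (intro continuous_on_powr_complex continuous_intros) auto
  obtain B where B: "\<And>t. t \<in> {0..1} \<Longrightarrow> norm (g t) \<le> B"
    using compact_imp_bounded[OF compact_continuous_image[OF g_cont compact_Icc]]
    unfolding bounded_iff by blast
  have lim: "uniform_limit {0..1} (\<lambda>n t. \<Sum>k<n. f k t) (\<lambda>t. \<Sum>k. f k t) sequentially"
  proof (rule Weierstrass_m_test)
    fix k and t :: real assume t: "t \<in> {0..1}"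
    have "norm (of_real t ^ (j + k) * g t) \<le> 1 * B"
      unfolding norm_mult using t B[OF t] by (intro mult_mono) (auto simp: norm_power power_le_one)
    then have "norm (f k t) \<le> norm (pochhammer \<gamma> k / fact k * u ^ k) * (1 * B)"
      unfolding f_def norm_mult[of "pochhammer \<gamma> k / fact k * u ^ k"] by (intro mult_left_mono) auto
    then show "norm (f k t) \<le> norm (pochhammer \<gamma> k / fact k * u ^ k) * B"
      by simp
  next
    show "summable (\<lambda>k. norm (pochhammer \<gamma> k / fact k * u ^ k) * B)"
      by (intro summable_mult2 binomial_series_abs_summable u)
  qed
  have f_sum: "(\<Sum>k. f k t) = of_real t ^ j * g t * (1 - u * of_real t) powr (- \<gamma>)" if t: "t \<in> {0..1}" for t
  proof -
    have "norm (u * of_real t) \<le> norm u * 1"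
      unfolding norm_mult using t by (intro mult_left_mono) auto
    then have "norm (u * of_real t) < 1" using u by simp
    from sums_mult[OF binomial_series[OF this], of "of_real t ^ j * g t" \<gamma>]
    have "(\<lambda>k. f k t) sums (of_real t ^ j * g t * (1 - u * of_real t) powr (- \<gamma>))"
      by (simp add: f_def power_add power_mult_distrib mult_ac)
    then show ?thesis by (rule sums_unique[symmetric])
  qed
  have f_int: "(f k has_integral pochhammer \<gamma> k / fact k * u ^ k * (fact (j + k) / pochhammer \<beta> (Suc (j + k)))) {0..1}" for k
    unfolding f_def g_def using \<beta> by (intro has_integral_mult_right Beta_integral_nat) auto
  have f_cont: "continuous_on {0..1} (\<lambda>t. \<Sum>k<n. f k t)" for n
    unfolding f_def by (intro continuous_intros g_cont)
  obtain I K where I: "\<And>n. ((\<lambda>t. \<Sum>k<n. f k t) has_integral I n) {0..1}"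
    and K: "((\<lambda>t. \<Sum>k. f k t) has_integral K) {0..1}" and IK: "I \<longlonglongrightarrow> K"
    using uniform_limit_integral[OF lim f_cont] by (metis sequentially_bot)
  have "I = (\<lambda>n. \<Sum>k<n. pochhammer \<gamma> k / fact k * u ^ k * (fact (j + k) / pochhammer \<beta> (Suc (j + k))))"
  proof
    fix n
    show "I n = (\<Sum>k<n. pochhammer \<gamma> k / fact k * u ^ k * (fact (j + k) / pochhammer \<beta> (Suc (j + k))))"
      using I[of n] has_integral_sum[OF finite_lessThan[of n] f_int] by (rule has_integral_unique)
  qed
  moreover have "K = Euler_integral \<beta> \<gamma> j u"
  proof -
    have "K = integral {0..1} (\<lambda>t. \<Sum>k. f k t)"
      using K by (simp add: integral_unique)
    also have "\<dots> = Euler_integral \<beta> \<gamma> j u"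
      unfolding Euler_integral_def by (intro integral_cong) (simp add: f_sum g_def)
    finally show ?thesis .
  qed
  ultimately show ?thesis
    using IK by (simp only: sums_def)
qed

lemma Euler_integral_eq_hypergeo:
  assumes \<beta>: "Re \<beta> > 1" and u: "norm u < 1"
  shows "eval_fps (fps_hypergeo [of_nat (Suc j), \<gamma>] [\<beta> + of_nat (Suc j)] 1) u =
    pochhammer \<beta> (Suc j) / fact j * Euler_integral \<beta> \<gamma> j u"
proof -
  have nz: "pochhammer \<beta> k \<noteq> 0" for k
  proof
    assume "pochhammer \<beta> k = 0"
    then obtain i where "\<beta> = - of_nat i"
      by (auto simp: pochhammer_eq_0_iff)
    then show False using \<beta> by simp
  qed
  have "pochhammer \<beta> (Suc j) / fact j * (pochhammer \<gamma> k / fact k * u ^ k * (fact (j + k) / pochhammer \<beta> (Suc (j + k)))) =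
     pochhammer (of_nat (Suc j)) k * pochhammer \<gamma> k / (pochhammer (\<beta> + of_nat (Suc j)) k * fact k) * u ^ k" for k
  proof -
    have 1: "pochhammer \<beta> (Suc (j + k)) = pochhammer \<beta> (Suc j) * pochhammer (\<beta> + of_nat (Suc j)) k"
      using pochhammer_product'[of \<beta> "Suc j" k] by simp
    have 2: "fact (j + k) = fact j * pochhammer (of_nat (Suc j) :: complex) k"
      using pochhammer_product'[of "1 :: complex" j k] by (simp add: pochhammer_fact[symmetric] add.commute)
    show ?thesis
      unfolding 1 2 using nz[of "Suc j"] by (simp add: mult_ac)
  qed
  with sums_mult[OF Euler_integral_sums[OF \<beta> u, of \<gamma> j], of "pochhammer \<beta> (Suc j) / fact j"]
  have "(\<lambda>k. pochhammer (of_nat (Suc j)) k * pochhammer \<gamma> k / (pochhammer (\<beta> + of_nat (Suc j)) k * fact k) * u ^ k)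
      sums (pochhammer \<beta> (Suc j) / fact j * Euler_integral \<beta> \<gamma> j u)"
    by (simp only:)
  then show ?thesis
    unfolding eval_fps_hypergeo_21 by (rule sums_unique[symmetric])
qed


text \<open>For t in [0, 1] the base 1 - u t meets the cut of the power only if u is real and at
  least 1. Differentiation under the integral is carried out on balls, which are convex, unlike the
  slit plane.\<close>

lemma Euler_integral_holomorphic:
  assumes \<beta>: "Re \<beta> > 1"
  shows "Euler_integral \<beta> \<gamma> j holomorphic_on slit_plane"
proof -
  define f where "f = (\<lambda>u t. of_real t ^ j * complex_of_real (1 - t) powr (\<beta> - 1) * (1 - u * of_real t) powr (- \<gamma>))"
  define f' where "f' = (\<lambda>u t. of_real t ^ j * complex_of_real (1 - t) powr (\<beta> - 1) * (\<gamma> * of_real t * (1 - u * of_real t) powr (- \<gamma> - 1)))"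
  have slit: "1 - u * of_real t \<notin> \<real>\<^sub>\<le>\<^sub>0" if u: "u \<in> slit_plane" and t: "t \<in> {0..1}" for u and t :: real
  proof
    assume "1 - u * of_real t \<in> \<real>\<^sub>\<le>\<^sub>0"
    then obtain r where r: "1 - u * of_real t = of_real r" "r \<le> 0"
      by (auto elim!: nonpos_Reals_cases)
    have "t \<noteq> 0" using r by (auto simp: complex_eq_iff)
    then have "u = of_real ((1 - r) / t)"
      using r(1) by (simp add: field_simps)
    moreover have "(1 - r) / t \<ge> 1"
      using r(2) t \<open>t \<noteq> 0\<close> by (simp add: field_simps)
    ultimately have "u \<in> complex_of_real ` {1..}"
      by blast
    then show False using u by (simp add: slit_plane_def)
  qed
  have powr_cont: "continuous_on X (\<lambda>p. (1 - fst p * of_real (snd p)) powr a)"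
    if X: "X \<subseteq> slit_plane \<times> {0..1}" for a and X :: "(complex \<times> real) set"
  proof (rule continuous_on_powr_complex)
    show "X \<subseteq> {p. 0 \<le> Re (1 - fst p * of_real (snd p)) \<or> Im (1 - fst p * of_real (snd p)) \<noteq> 0}"
      using X slit by (fastforce simp: complex_nonpos_Reals_iff)
    show "0 < Re a" if "p \<in> X" "1 - fst p * of_real (snd p) = 0" for p
      using that slit[of "fst p" "snd p"] X by force
  qed (intro continuous_intros)+
  have base_cont: "continuous_on X (\<lambda>p. complex_of_real (1 - snd p) powr (\<beta> - 1))"
    if "X \<subseteq> slit_plane \<times> {0..1}" for X :: "(complex \<times> real) set"
    using \<beta> that by (intro continuous_on_powr_complex continuous_intros) auto
  have local: "Euler_integral \<beta> \<gamma> j holomorphic_on ball w e" if sub: "ball w e \<subseteq> slit_plane" for w e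
  proof -
    have "(\<lambda>u. integral (cbox 0 1) (f u)) holomorphic_on ball w e"
    proof (rule leibniz_rule_holomorphic[where fx = f'])
      fix u and t :: real assume u: "u \<in> ball w e" and t: "t \<in> cbox 0 1"
      have "1 - u * of_real t \<notin> \<real>\<^sub>\<le>\<^sub>0"
        using u t sub by (intro slit) auto
      then show "((\<lambda>u. f u t) has_field_derivative f' u t) (at u within ball w e)"
        unfolding f_def f'_def by (auto intro!: derivative_eq_intros)
    next
      fix u assume u: "u \<in> ball w e"
      have "continuous_on (cbox 0 1) (\<lambda>t::real. (\<lambda>p. f (fst p) (snd p)) (u, t))"
      proof (rule continuous_on_compose2[where s = "cbox 0 1" and f = "\<lambda>t. (u, t)"])
        show "continuous_on (slit_plane \<times> {0..1}) (\<lambda>p. f (fst p) (snd p))"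
          unfolding f_def by (intro continuous_intros powr_cont base_cont) auto
        show "continuous_on (cbox 0 1) (\<lambda>t::real. (u, t))"
          by (intro continuous_intros)
      qed (use u sub in auto)
      then show "f u integrable_on cbox 0 1"
        by (intro integrable_continuous) simp
    next
      show "continuous_on (ball w e \<times> cbox 0 1) (\<lambda>(u, t). f' u t)"
        unfolding f'_def case_prod_unfold
        by (intro continuous_intros powr_cont base_cont) (use sub in auto)
    qed auto
    then show ?thesis
      by (simp add: Euler_integral_def[abs_def] f_def)
  qed
  show ?thesis
    unfolding holomorphic_on_def
  proof
    fix w assume "w \<in> slit_plane"
    then obtain e where "e > 0" "ball w e \<subseteq> slit_plane"
      using openE[OF open_slit_plane] by blast
    then have "Euler_integral \<beta> \<gamma> j field_differentiable at w"
      using holomorphic_on_imp_differentiable_at[OF local open_ball] by auto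
    then show "Euler_integral \<beta> \<gamma> j field_differentiable at w within slit_plane"
      by (rule field_differentiable_at_within)
  qed
qed


subsection \<open>Hypergeometric series\<close>

lemma tends_half_add_of_nat_divide: "tends_half (\<lambda>n. (a + of_nat n) / of_nat n) 1"
proof (rule tends_half_I_nat)
  show "\<forall>\<^sub>F n in sequentially. norm ((a + of_nat n) / of_nat n - 1) \<le> norm a / real n"
    using eventually_gt_at_top[of 0]
  proof eventually_elim
    case (elim n)
    then have "(a + of_nat n) / of_nat n - 1 = a / of_nat n"
      by (simp add: field_simps)
    then show ?case by (simp add: norm_divide)
  qed
qed

lemma tends_half_of_nat_ratio: "tends_half (\<lambda>n. (a + of_nat n) / (b + of_nat n)) 1"
proof -
  have "tends_half (\<lambda>n. ((a + of_nat n) / of_nat n) / ((b + of_nat n) / of_nat n)) (1 / 1)"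
    by (intro tends_half_divide tends_half_add_of_nat_divide) simp
  moreover have "\<forall>\<^sub>F n in sequentially. ((a + of_nat n) / of_nat n) / ((b + of_nat n) / of_nat n) = (a + of_nat n) / (b + of_nat n)"
    using eventually_gt_at_top[of 0] by eventually_elim simp
  ultimately show ?thesis
    using tends_half_cong by fastforce
qed

lemma hypergeo_summable:
  fixes a b c u :: complex
  assumes c: "c \<notin> \<int>\<^sub>\<le>\<^sub>0" and u: "norm u < 1"
  shows "summable (\<lambda>n. pochhammer a n * pochhammer b n / (pochhammer c n * fact n) * u ^ n)"
proof -
  define f where "f = (\<lambda>n. pochhammer a n * pochhammer b n / (pochhammer c n * fact n) * u ^ n)"
  define r where "r = (\<lambda>n. ((a + of_nat n) / (c + of_nat n)) * ((b + of_nat n) / (1 + of_nat n)) * u)"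
  define q where "q = (norm u + 1) / 2"
  have q: "norm u < q" "q < 1" using u by (auto simp: q_def)
  have step: "f (Suc n) = r n * f n" for n
    by (simp add: f_def r_def pochhammer_Suc divide_inverse mult_ac)
  have "tends_half r (1 * 1 * u)"
    unfolding r_def by (intro tends_half_mult tends_half_of_nat_ratio tends_half_const)
  then have "(\<lambda>n. norm (r n)) \<longlonglongrightarrow> norm u"
    using tends_half_LIMSEQ tendsto_norm by fastforce
  then have "\<forall>\<^sub>F n in sequentially. norm (r n) < q"
    using q(1) by (rule order_tendstoD)
  then obtain N where N: "\<And>n. n \<ge> N \<Longrightarrow> norm (r n) < q"
    by (auto simp: eventually_sequentially)
  have "summable f"
  proof (rule summable_ratio_test[OF q(2)])
    fix n assume "n \<ge> N"
    then show "norm (f (Suc n)) \<le> q * norm (f n)"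
      unfolding step norm_mult using N[of n] by (intro mult_right_mono) auto
  qed
  then show ?thesis by (simp add: f_def)
qed

abbreviation F21 :: "complex \<Rightarrow> complex \<Rightarrow> complex \<Rightarrow> complex \<Rightarrow> complex" where
  "F21 a b c u \<equiv> eval_fps (fps_hypergeo [a, b] [c] 1) u"

lemma F21_commute: "F21 a b c u = F21 b a c u"
  unfolding eval_fps_hypergeo_21 by (simp add: mult.commute)

lemma add_of_nat_not_nonpos_Ints:
  fixes c :: complex
  assumes "c \<notin> \<int>\<^sub>\<le>\<^sub>0"
  shows "c + of_nat n \<notin> \<int>\<^sub>\<le>\<^sub>0"
proof
  assume "c + of_nat n \<in> \<int>\<^sub>\<le>\<^sub>0"
  then have "c + of_nat n - of_nat n \<in> \<int>\<^sub>\<le>\<^sub>0"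
    by (intro nonpos_Ints_diff_Nats) auto
  with assms show False by simp
qed

lemma add_of_nat_nonzero:
  fixes c :: complex
  assumes "c \<notin> \<int>\<^sub>\<le>\<^sub>0"
  shows "c + of_nat n \<noteq> 0"
  using add_of_nat_not_nonpos_Ints[OF assms, of n] by (metis zero_in_nonpos_Ints)

text \<open>Coefficients are compared: the constant terms cancel, and the difference of the (n+1)-st
  ones carries a factor n + 1 that reduces (n+1)! to n!. Both kinds of partial numerators arise from
  this one relation, as the upper parameters may be exchanged.\<close>

lemma F21_contiguous:
  assumes c: "c \<notin> \<int>\<^sub>\<le>\<^sub>0" and u: "norm u < 1"
  shows "F21 a b c u = F21 a (b + 1) (c + 1) u - a * (c - b) / (c * (c + 1)) * u * F21 (a + 1) (b + 1) (c + 2) u"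
proof -
  have c': "c + 1 \<notin> \<int>\<^sub>\<le>\<^sub>0" "c + 2 \<notin> \<int>\<^sub>\<le>\<^sub>0" "c \<noteq> 0" "c + 1 \<noteq> 0"
    using add_of_nat_not_nonpos_Ints[OF c, of 1] add_of_nat_not_nonpos_Ints[OF c, of 2] c by auto
  define f where "f = (\<lambda>a b c n. pochhammer a n * pochhammer b n / (pochhammer c n * fact n) :: complex)"
  have sm: "summable (\<lambda>n. f a b c n * u ^ n)" if "c \<notin> \<int>\<^sub>\<le>\<^sub>0" for a b c
    unfolding f_def by (rule hypergeo_summable[OF that u])
  have F21_eq: "F21 a b c u = (\<Sum>n. f a b c n * u ^ n)" for a b c
    unfolding eval_fps_hypergeo_21 f_def ..
  have coeff: "f a b c (Suc n) - f a (b + 1) (c + 1) (Suc n) = - (a * (c - b) / (c * (c + 1))) * f (a + 1) (b + 1) (c + 2) n" for n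
  proof -
    have nz: "pochhammer (c + 2) n \<noteq> 0" "c + 1 + of_nat n \<noteq> 0" "of_nat (Suc n) \<noteq> (0 :: complex)" "fact n \<noteq> (0 :: complex)"
      using c'(2) add_of_nat_nonzero[OF c'(1), of n] by (auto simp: pochhammer_eq_0_iff simp del: of_nat_Suc)
    define A B C where "A = pochhammer (a + 1) n" and "B = pochhammer (b + 1) n" and "C = pochhammer (c + 2) n"
    have pa: "pochhammer a (Suc n) = a * A" "pochhammer b (Suc n) = b * B"
      unfolding A_def B_def by (rule pochhammer_rec)+
    have pb: "pochhammer (b + 1) (Suc n) = B * (b + 1 + of_nat n)"
      unfolding B_def by (rule pochhammer_Suc)
    have pc1: "pochhammer (c + 1) (Suc n) = (c + 1) * C"
      using pochhammer_rec[of "c + 1" n] by (simp add: C_def add.assoc)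
    have "pochhammer c (Suc (Suc n)) = c * ((c + 1) * C)"
      using pochhammer_rec[of c "Suc n"] pc1 by simp
    moreover have "pochhammer c (Suc (Suc n)) = pochhammer c (Suc n) * (c + 1 + of_nat n)"
      by (simp add: pochhammer_Suc[of c "Suc n"] add_ac)
    ultimately have pc: "pochhammer c (Suc n) = c * (c + 1) * C / (c + 1 + of_nat n)"
      using nz by (simp add: field_simps)
    have "f a b c (Suc n) - f a (b + 1) (c + 1) (Suc n) =
       a * A * B / ((c + 1) * C * (of_nat (Suc n) * fact n)) * (b * (c + 1 + of_nat n) / c - (b + 1 + of_nat n))"
      unfolding f_def pa pb pc pc1 fact_Suc using nz c' unfolding C_def[symmetric]
      by (simp add: divide_simps del: of_nat_Suc) (simp add: algebra_simps)
    also have "b * (c + 1 + of_nat n) / c - (b + 1 + of_nat n) = - ((c - b) * of_nat (Suc n) / c)"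
      using c' by (simp add: field_simps)
    also have "a * A * B / ((c + 1) * C * (of_nat (Suc n) * fact n)) * (- ((c - b) * of_nat (Suc n) / c)) =
        - (a * (c - b) / (c * (c + 1))) * f (a + 1) (b + 1) (c + 2) n"
      unfolding f_def A_def B_def C_def using nz by (simp del: of_nat_Suc add: mult_ac)
    finally show ?thesis .
  qed
  have "F21 a b c u - F21 a (b + 1) (c + 1) u = (\<Sum>n. f a b c n * u ^ n - f a (b + 1) (c + 1) n * u ^ n)"
    unfolding F21_eq by (rule suminf_diff[OF sm[OF c] sm[OF c'(1)]])
  also have "\<dots> = (\<Sum>n. f a b c (Suc n) * u ^ Suc n - f a (b + 1) (c + 1) (Suc n) * u ^ Suc n) +
      (f a b c 0 * u ^ 0 - f a (b + 1) (c + 1) 0 * u ^ 0)"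
    by (subst suminf_split_head[OF summable_diff[OF sm[OF c] sm[OF c'(1)]]]) simp
  also have "\<dots> = (\<Sum>n. - (a * (c - b) / (c * (c + 1))) * u * (f (a + 1) (b + 1) (c + 2) n * u ^ n))"
  proof -
    have "f a b c (Suc n) * u ^ Suc n - f a (b + 1) (c + 1) (Suc n) * u ^ Suc n =
        - (a * (c - b) / (c * (c + 1))) * u * (f (a + 1) (b + 1) (c + 2) n * u ^ n)" for n
      unfolding left_diff_distrib[symmetric] coeff by simp
    then show ?thesis by (simp add: f_def)
  qed
  also have "\<dots> = - (a * (c - b) / (c * (c + 1))) * u * F21 (a + 1) (b + 1) (c + 2) u"
    unfolding F21_eq by (rule suminf_mult[OF sm[OF c'(2)]])
  finally show ?thesis
    by (simp add: algebra_simps)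
qed

text \<open>The start of the recurrence. Formally it is the contiguous relation at F(b, 0; c - 1; u)
  = 1, but there the factor c - 1 has to be cancelled, which fails for c = 1; splitting off the
  first term of the series gives the cancelled form at once.\<close>

lemma F21_1_head:
  assumes c: "c \<notin> \<int>\<^sub>\<le>\<^sub>0" and u: "norm u < 1"
  shows "F21 1 b c u = 1 + b * u / c * F21 1 (b + 1) (c + 1) u"
proof -
  have c': "c + 1 \<notin> \<int>\<^sub>\<le>\<^sub>0"
    using add_of_nat_not_nonpos_Ints[OF c, of 1] by auto
  define f where "f = (\<lambda>b c n. pochhammer b n / pochhammer c n * u ^ n)"
  have eq: "pochhammer 1 n * pochhammer b n / (pochhammer c n * fact n) * u ^ n = f b c n" for b c n
    by (simp add: f_def pochhammer_fact[symmetric])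
  have sm: "summable (f b c)" if "c \<notin> \<int>\<^sub>\<le>\<^sub>0" for b c
    using hypergeo_summable[OF that u, of 1 b] by (simp only: eq)
  have "F21 1 b c u = (\<Sum>n. f b c n)"
    unfolding eval_fps_hypergeo_21 eq by simp
  also have "\<dots> = (\<Sum>n. f b c (Suc n)) + f b c 0"
    by (subst suminf_split_head[OF sm[OF c]]) simp
  also have "(\<Sum>n. f b c (Suc n)) = (\<Sum>n. b * u / c * f (b + 1) (c + 1) n)"
    by (simp add: f_def pochhammer_rec mult_ac)
  also have "(\<Sum>n. b * u / c * f (b + 1) (c + 1) n) = b * u / c * F21 1 (b + 1) (c + 1) u"
    unfolding eval_fps_hypergeo_21 eq by (rule suminf_mult[OF sm[OF c']])
  finally show ?thesis
    by (simp add: f_def)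
qed


subsection \<open>Gauss's continued fraction\<close>

locale gauss_fraction =
  fixes b c :: complex
  assumes b: "b \<notin> \<int>\<^sub>\<le>\<^sub>0" and c: "c \<notin> \<int>\<^sub>\<le>\<^sub>0" and cb: "c - b \<notin> \<int>\<^sub>\<le>\<^sub>0"
begin

text \<open>The power series on the unit disc, as opposed to its continuation \<open>P\<close>.
  Identities are proved for the series and carried over by uniqueness of the continuation.\<close>

definition Pser :: "nat \<Rightarrow> complex \<Rightarrow> complex" where
  "Pser n u = (if n = 0 then 1 else F21 (of_nat (Suc n div 2)) (b + of_nat (n div 2)) (c + of_nat (n - 1)) u)"

definition P :: "nat \<Rightarrow> complex \<Rightarrow> complex" where
  "P n u = (if n = 0 then 1 else hyp2F1 (of_nat (Suc n div 2)) (b + of_nat (n div 2)) (c + of_nat (n - 1)) u)"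

lemma odd_even_cases:
  fixes n :: nat
  obtains "n = 0" | m where "n = 2 * m + 1" | m where "n = 2 * m + 2"
proof (cases "even n")
  case True
  then obtain k where k: "n = 2 * k" by (elim evenE)
  then show ?thesis using that(1) that(3)[of "k - 1"] by (cases k) auto
next
  case False
  then show ?thesis using that(2) by (elim oddE) auto
qed

text \<open>Starting at index 3 passes over the cancelled numerator, and every factor takes the form
  d + \<open>of_nat k\<close>, where d avoiding the nonpositive integers excludes zeros.\<close>

lemma Rstar_odd': "Rstar b c u (2 * m + 3) =
    - ((b + of_nat (m + 1)) * (c + of_nat m) * u / ((c + of_nat (2 * m + 1)) * (c + of_nat (2 * m + 2))))"
  using Rstar_odd[of "m + 1" c b u] by (simp add: algebra_simps eval_nat_numeral)

lemma Rstar_even': "Rstar b c u (2 * m + 2) =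
    - (of_nat (m + 1) * (c - b + of_nat m) * u / ((c + of_nat (2 * m)) * (c + of_nat (2 * m + 1))))"
  using Rstar_even[of b c u m] by (simp add: algebra_simps)

lemma Rstar_1: "Rstar b c u 1 = - (b * u / c)"
  by (simp add: Rstar_def)

lemma Rstar_linear: "Rstar b c u (Suc n) = Rstar b c 1 (Suc n) * u"
  by (simp add: Rstar_def Let_def)

lemma Pser_rec:
  assumes u: "norm u < 1"
  shows "Pser n u = Pser (Suc n) u + Rstar b c u (Suc n) * Pser (Suc (Suc n)) u"
proof (cases n rule: odd_even_cases)
  case 1
  have "F21 1 b c u = 1 + b * u / c * F21 1 (b + 1) (c + 1) u"
    by (rule F21_1_head[OF c u])
  then show ?thesis
    using 1 Rstar_1[of u] by (simp add: Pser_def)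
next
  case (2 m)
  define A B C where "A = (of_nat (m + 1) :: complex)" and "B = b + of_nat m" and "C = c + of_nat (2 * m)"
  have P: "Pser n u = F21 A B C u" "Pser (Suc n) u = F21 A (B + 1) (C + 1) u"
      "Pser (Suc (Suc n)) u = F21 (A + 1) (B + 1) (C + 2) u"
    by (simp_all add: Pser_def 2 A_def B_def C_def algebra_simps)
  have R: "Rstar b c u (Suc n) = - (A * (C - B) / (C * (C + 1)) * u)"
    using Rstar_even'[of u m] by (simp add: 2 A_def B_def C_def algebra_simps)
  have "C \<notin> \<int>\<^sub>\<le>\<^sub>0"
    unfolding C_def by (rule add_of_nat_not_nonpos_Ints[OF c])
  from F21_contiguous[OF this u, of A B] show ?thesis
    unfolding P R by simp
next
  case (3 m)
  \<comment> \<open>The upper parameters are exchanged here: the one containing b is kept by the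
    first step of the contiguous relation, the integer one is raised.\<close>
  define A B C where "A = b + of_nat (m + 1)" and "B = (of_nat (m + 1) :: complex)" and "C = c + of_nat (2 * m + 1)"
  have P: "Pser n u = F21 A B C u" "Pser (Suc n) u = F21 A (B + 1) (C + 1) u"
      "Pser (Suc (Suc n)) u = F21 (A + 1) (B + 1) (C + 2) u"
    unfolding F21_commute[of A] F21_commute[of "A + 1"]
    by (simp_all add: Pser_def 3 A_def B_def C_def algebra_simps)
  have R: "Rstar b c u (Suc n) = - (A * (C - B) / (C * (C + 1)) * u)"
    using Rstar_odd'[of u m] by (simp add: 3 A_def B_def C_def algebra_simps eval_nat_numeral)
  have "C \<notin> \<int>\<^sub>\<le>\<^sub>0"
    unfolding C_def by (rule add_of_nat_not_nonpos_Ints[OF c])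
  from F21_contiguous[OF this u, of A B] show ?thesis
    unfolding P R by simp
qed

lemma Pser_odd_integral:
  assumes "Re (c + of_nat m - 1) > 1" "norm u < 1"
  shows "Pser (2 * m + 1) u = pochhammer (c + of_nat m - 1) (Suc m) / fact m * Euler_integral (c + of_nat m - 1) (b + of_nat m) m u"
  using Euler_integral_eq_hypergeo[OF assms, of m "b + of_nat m"] by (simp add: Pser_def algebra_simps)

lemma Pser_even_integral:
  assumes "Re (c + of_nat m) > 1" "norm u < 1"
  shows "Pser (2 * m + 2) u = pochhammer (c + of_nat m) (Suc m) / fact m * Euler_integral (c + of_nat m) (b + of_nat m + 1) m u"
  using Euler_integral_eq_hypergeo[OF assms, of m "b + of_nat m + 1"] by (simp add: Pser_def algebra_simps)

text \<open>The integral representation requires a large real part of the lower parameter and so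
  covers large n only. The recurrence writes each earlier function through the next two with
  coefficients linear in u, and so hands the continuation down. Existence is what gives the
  description in \<open>hyp2F1\<close> a meaning.\<close>

lemma Pser_extends: "\<exists>f. f holomorphic_on slit_plane \<and> (\<forall>u. norm u < 1 \<longrightarrow> f u = Pser n u)"
proof -
  obtain M where M: "real M > 2 - Re c"
    using reals_Archimedean2 by blast
  have large: "\<exists>f. f holomorphic_on slit_plane \<and> (\<forall>u. norm u < 1 \<longrightarrow> f u = Pser n u)" if n: "n \<ge> 2 * M + 1" for n
  proof (cases n rule: odd_even_cases)
    case 1
    then show ?thesis using n by simp
  next
    case (2 m)
    have m: "Re (c + of_nat m - 1) > 1" using n 2 M by simp
    show ?thesis
      by (rule exI[of _ "\<lambda>u. pochhammer (c + of_nat m - 1) (Suc m) / fact m * Euler_integral (c + of_nat m - 1) (b + of_nat m) m u"])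
        (use Pser_odd_integral[OF m] 2 in \<open>auto intro!: holomorphic_intros Euler_integral_holomorphic[OF m]\<close>)
  next
    case (3 m)
    have m: "Re (c + of_nat m) > 1" using n 3 M by simp
    show ?thesis
      by (rule exI[of _ "\<lambda>u. pochhammer (c + of_nat m) (Suc m) / fact m * Euler_integral (c + of_nat m) (b + of_nat m + 1) m u"])
        (use Pser_even_integral[OF m] 3 in \<open>auto intro!: holomorphic_intros Euler_integral_holomorphic[OF m]\<close>)
  qed
  have R_holo: "(\<lambda>u. Rstar b c u (Suc n)) holomorphic_on slit_plane" for n
    by (subst Rstar_linear[abs_def]) (intro holomorphic_intros)
  have downward: "\<exists>f. f holomorphic_on slit_plane \<and> (\<forall>u. norm u < 1 \<longrightarrow> f u = Pser n u)"
    if ext: "\<exists>f. f holomorphic_on slit_plane \<and> (\<forall>u. norm u < 1 \<longrightarrow> f u = Pser (Suc n) u)"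
      "\<exists>f. f holomorphic_on slit_plane \<and> (\<forall>u. norm u < 1 \<longrightarrow> f u = Pser (Suc (Suc n)) u)" for n
  proof -
    obtain f g where "f holomorphic_on slit_plane" "\<forall>u. norm u < 1 \<longrightarrow> f u = Pser (Suc n) u"
        "g holomorphic_on slit_plane" "\<forall>u. norm u < 1 \<longrightarrow> g u = Pser (Suc (Suc n)) u"
      using ext by blast
    then show ?thesis
      using Pser_rec[of _ n] by (intro exI[of _ "\<lambda>u. f u + Rstar b c u (Suc n) * g u"]) (auto intro!: holomorphic_intros R_holo)
  qed
  have "\<exists>f. f holomorphic_on slit_plane \<and> (\<forall>u. norm u < 1 \<longrightarrow> f u = Pser (2 * M + 1 - k) u)" for k
  proof (induction k rule: less_induct)
    case (less k)
    show ?case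
    proof (cases "k = 0 \<or> k > 2 * M + 1")
      case True
      then show ?thesis using large[of "2 * M + 1"] less[of "2 * M + 1"] by auto
    next
      case False
      define n where "n = 2 * M + 1 - k"
      have "\<exists>f. f holomorphic_on slit_plane \<and> (\<forall>u. norm u < 1 \<longrightarrow> f u = Pser (Suc n) u)"
        using less[of "k - 1"] False by (simp add: n_def Suc_diff_le)
      moreover have "\<exists>f. f holomorphic_on slit_plane \<and> (\<forall>u. norm u < 1 \<longrightarrow> f u = Pser (Suc (Suc n)) u)"
      proof (cases "k = 1")
        case True
        then show ?thesis using large[of "2 * M + 2"] by (simp add: n_def)
      next
        case False
        then have "Suc (Suc n) = 2 * M + 1 - (k - 2)"
          using \<open>\<not> (k = 0 \<or> k > 2 * M + 1)\<close> unfolding n_def by linarith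
        then show ?thesis using less[of "k - 2"] \<open>\<not> (k = 0 \<or> k > 2 * M + 1)\<close> by simp
      qed
      ultimately show ?thesis
        unfolding n_def[symmetric] by (rule downward)
    qed
  qed
  from this[of "2 * M + 1 - n"] show ?thesis
    using large[of n] by (cases "n \<ge> 2 * M + 1") auto
qed

lemma P_eqI:
  assumes "f holomorphic_on slit_plane" "\<And>u. norm u < 1 \<Longrightarrow> f u = Pser n u" "z \<in> slit_plane"
  shows "P n z = f z"
proof (cases "n = 0")
  case True
  have "f z = 1"
    by (rule analytic_continuation_open[of "ball 0 1" slit_plane f "\<lambda>_. 1"])
      (use assms True open_slit_plane connected_slit_plane ball_subset_slit_plane in \<open>auto simp: Pser_def\<close>)
  then show ?thesis by (simp add: P_def True)
next
  case False
  then show ?thesis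
    unfolding P_def using assms by (auto intro!: hyp2F1_eqI simp: Pser_def)
qed

lemma P_rec:
  assumes z: "z \<in> slit_plane"
  shows "P n z = P (Suc n) z + Rstar b c z (Suc n) * P (Suc (Suc n)) z"
proof -
  obtain f where f: "f holomorphic_on slit_plane" "\<And>u. norm u < 1 \<Longrightarrow> f u = Pser (Suc n) u"
    using Pser_extends by blast
  obtain g where g: "g holomorphic_on slit_plane" "\<And>u. norm u < 1 \<Longrightarrow> g u = Pser (Suc (Suc n)) u"
    using Pser_extends by blast
  have R_holo: "(\<lambda>u. Rstar b c u (Suc n)) holomorphic_on slit_plane"
    by (subst Rstar_linear[abs_def]) (intro holomorphic_intros)
  have "P n z = f z + Rstar b c z (Suc n) * g z"
  proof (rule P_eqI)
    show "(\<lambda>z. f z + Rstar b c z (Suc n) * g z) holomorphic_on slit_plane"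
      by (intro holomorphic_intros f g R_holo)
  qed (use f g z Pser_rec[of _ n] in auto)
  moreover have "P (Suc n) z = f z" "P (Suc (Suc n)) z = g z"
    using f g z by (auto intro!: P_eqI)
  ultimately show ?thesis by simp
qed

lemma P_odd_integral:
  assumes m: "Re (c + of_nat m - 1) > 1" and z: "z \<in> slit_plane"
  shows "P (2 * m + 1) z = pochhammer (c + of_nat m - 1) (Suc m) / fact m * Euler_integral (c + of_nat m - 1) (b + of_nat m) m z"
  by (rule P_eqI[OF _ _ z])
    (use Pser_odd_integral[OF m] in \<open>auto intro!: holomorphic_intros Euler_integral_holomorphic[OF m]\<close>)

lemma P_even_integral:
  assumes m: "Re (c + of_nat m) > 1" and z: "z \<in> slit_plane"
  shows "P (2 * m + 2) z = pochhammer (c + of_nat m) (Suc m) / fact m * Euler_integral (c + of_nat m) (b + of_nat m + 1) m z"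
  by (rule P_eqI[OF _ _ z])
    (use Pser_even_integral[OF m] in \<open>auto intro!: holomorphic_intros Euler_integral_holomorphic[OF m]\<close>)

text \<open>With b, c and c - b outside the nonpositive integers the fraction does not terminate, so
  the Casoratian never vanishes and the recurrence can be inverted.\<close>

lemma Rstar_nonzero:
  assumes "u \<noteq> 0"
  shows "Rstar b c u (Suc n) \<noteq> 0"
proof (cases n rule: odd_even_cases)
  case 1
  then show ?thesis
    using assms Rstar_1[of u] b c by auto
next
  case (2 m)
  show ?thesis
    using assms Rstar_even'[of u m] add_of_nat_nonzero[OF cb, of m] add_of_nat_nonzero[OF c, of "2 * m"]
      add_of_nat_nonzero[OF c, of "2 * m + 1"]
    by (simp add: 2 del: of_nat_add of_nat_mult of_nat_Suc)
next
  case (3 m)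
  show ?thesis
    using assms Rstar_odd'[of u m] add_of_nat_nonzero[OF b, of "m + 1"] add_of_nat_nonzero[OF c, of m]
      add_of_nat_nonzero[OF c, of "2 * m + 2"] add_of_nat_nonzero[OF c, of "2 * m + 1"]
    by (simp add: 3 eval_nat_numeral del: of_nat_add of_nat_mult of_nat_Suc)
qed

end


subsection \<open>Asymptotics of the minimal solution\<close>

text \<open>The limit is that of three Gamma series, whose powers of m cancel because b + (c - b) =
  c. In the quotient of consecutive terms numerator and denominator agree up to their constant
  terms, as (b + 1) + (c - b) = c + 1; their difference is \<open>K\<close>, so the quotient is 1 +
  O(1/m^2).\<close>

lemma pochhammer_ratio_tends_half:
  fixes b c :: complex
  assumes b: "b \<notin> \<int>\<^sub>\<le>\<^sub>0" and c: "c \<notin> \<int>\<^sub>\<le>\<^sub>0" and cb: "c - b \<notin> \<int>\<^sub>\<le>\<^sub>0"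
  shows "tends_half (\<lambda>m. pochhammer b (Suc m) * pochhammer (c - b) m / (pochhammer c m * fact m))
    (Gamma c / (Gamma b * Gamma (c - b)))"
proof (rule tends_half_of_ratio)
  let ?a = "\<lambda>m. pochhammer b (Suc m) * pochhammer (c - b) m / (pochhammer c m * fact m)"
  have nz: "pochhammer d m \<noteq> 0" if "d \<notin> \<int>\<^sub>\<le>\<^sub>0" for d :: complex and m
    using add_of_nat_nonzero[OF that] by (auto simp: pochhammer_eq_0_iff add_eq_0_iff2)
  show "?a m \<noteq> 0" for m
    using nz[OF b] nz[OF cb] nz[OF c] by simp
  show "?a \<longlonglongrightarrow> Gamma c / (Gamma b * Gamma (c - b))"
  proof -
    have eq: "?a m = rGamma_series b m * rGamma_series (c - b) m / rGamma_series c m * ((c + of_nat m) / (c - b + of_nat m))" for m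
    proof -
      define l where "l = complex_of_real (ln (real m))"
      have e: "exp (c * l) = exp (b * l) * exp ((c - b) * l)"
        by (simp add: exp_add[symmetric] algebra_simps)
      define X Y where "X = pochhammer (c - b) m" and "Y = pochhammer c m"
      define d C where "d = c - b + of_nat m" and "C = c + of_nat m"
      have p: "pochhammer (c - b) (m + 1) = X * d" "pochhammer c (m + 1) = Y * C"
        by (simp_all add: X_def Y_def d_def C_def pochhammer_Suc)
      have "d \<noteq> 0" "C \<noteq> 0" "Y \<noteq> 0"
        using add_of_nat_nonzero[OF cb, of m] add_of_nat_nonzero[OF c, of m] nz[OF c, of m]
        by (auto simp: d_def C_def Y_def)
      then show ?thesis
        unfolding rGamma_series_def l_def[symmetric] e p X_def[symmetric] Y_def[symmetric] d_def[symmetric] C_def[symmetric]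
        by simp
    qed
    have "(\<lambda>m. (c + of_nat m) / (c - b + of_nat m)) \<longlonglongrightarrow> 1"
      by (rule tends_half_LIMSEQ[OF tends_half_of_nat_ratio])
    then have "(\<lambda>m. rGamma_series b m * rGamma_series (c - b) m / rGamma_series c m * ((c + of_nat m) / (c - b + of_nat m)))
        \<longlonglongrightarrow> rGamma b * rGamma (c - b) / rGamma c * 1"
      using c by (intro tendsto_intros) (auto simp: rGamma_eq_zero_iff)
    then show ?thesis
      unfolding eq by (simp add: Gamma_def field_simps)
  qed
  define K where "K = (b + 1) * (c - b) - c"
  have bound: "norm (?a (Suc m) / ?a m - 1) \<le> 2 * norm K / (real m)\<^sup>2" if m: "m > 0" "real m \<ge> 2 * norm c" for m
  proof -
    have nz1: "c + of_nat m \<noteq> 0" "1 + of_nat m \<noteq> (0 :: complex)"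
      using add_of_nat_nonzero[OF c, of m] add_of_nat_nonzero[of 1 m] by auto
    have p: "pochhammer b (Suc (Suc m)) = pochhammer b (Suc m) * (b + 1 + of_nat m)"
      "pochhammer (c - b) (Suc m) = pochhammer (c - b) m * (c - b + of_nat m)"
      "pochhammer c (Suc m) = pochhammer c m * (c + of_nat m)"
      "fact (Suc m) = (1 + of_nat m) * (fact m :: complex)"
      using pochhammer_Suc[of b "Suc m"] by (simp_all add: pochhammer_Suc add_ac)
    have "?a (Suc m) / ?a m = (b + 1 + of_nat m) * (c - b + of_nat m) / ((c + of_nat m) * (1 + of_nat m))"
      unfolding p using nz[OF cb, of m] nz[OF c, of m] nz[OF b, of "Suc m"] nz1 by simp
    also have "(b + 1 + of_nat m) * (c - b + of_nat m) = K + (c + of_nat m) * (1 + of_nat m)"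
      by (simp add: K_def algebra_simps)
    finally have "?a (Suc m) / ?a m - 1 = K / ((c + of_nat m) * (1 + of_nat m))"
      unfolding add_divide_distrib using nz1 by simp
    then have "norm (?a (Suc m) / ?a m - 1) = norm K / (norm (c + of_nat m) * norm (1 + of_nat m :: complex))"
      by (simp add: norm_divide norm_mult)
    also have "\<dots> \<le> norm K / ((real m / 2) * real m)"
    proof (intro divide_left_mono mult_mono)
      have "norm (of_nat m :: complex) \<le> norm (c + of_nat m) + norm c"
        by (metis add_diff_cancel_left' norm_triangle_ineq4 add.commute)
      then show "real m / 2 \<le> norm (c + of_nat m)"
        using m by simp
      show "real m \<le> norm (1 + of_nat m :: complex)"
        by (metis norm_of_nat of_nat_1 of_nat_add of_nat_mono le_add2)
      show "0 < norm (c + of_nat m) * norm (1 + of_nat m :: complex) * (real m / 2 * real m)"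
        using nz1 m by (intro mult_pos_pos) auto
    qed auto
    also have "\<dots> = 2 * norm K / (real m)\<^sup>2"
      by (simp add: power2_eq_square)
    finally show ?thesis .
  qed
  show "\<forall>\<^sub>F m in sequentially. norm (?a (Suc m) / ?a m - 1) \<le> 2 * norm K / (real m)\<^sup>2"
    using eventually_gt_at_top[of 0] eventually_ge_at_top[of "nat \<lceil>2 * norm c\<rceil>"]
  proof eventually_elim
    case (elim m)
    then show ?case by (intro bound) (auto simp: nat_ceiling_le_eq)
  qed
qed

text \<open>The assumption on s excludes z = 0, where the partial numerators vanish and w =
  0.\<close>

locale gauss_asymptotics = gauss_fraction b c + laplace s for b c s +
  assumes s_neq_1: "s \<noteq> 1"
begin

definition w :: real where "w = z / (1 + s)\<^sup>2"
text \<open>Splitting off \<open>M\<close> powers of the kernel makes the remaining factor \<open>G\<close> of the Euler integrand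
  continuous at \<open>t = 1\<close>, whatever \<open>Re c\<close> is.\<close>

definition M :: nat where "M = nat \<lceil>4 - Re c\<rceil>"
definition G :: "complex \<Rightarrow> complex \<Rightarrow> real \<Rightarrow> complex" where
  "G p q t = of_real t ^ M * of_real (1 - t) powr p * of_real (1 - z * t) powr (- q)"

lemma z_nonzero: "z \<noteq> 0"
  using s s_neq_1 by (simp add: z_def power2_eq_1_iff)

lemma z_factor: "z = (1 - s) * (1 + s)"
  by (simp add: z_def power2_eq_square algebra_simps)

lemma w_eq: "w = (1 - s) / (1 + s)"
  using s by (simp add: w_def z_factor power2_eq_square)

lemma z_slit: "of_real z \<in> slit_plane"
proof -
  have "z < 1" using s by (simp add: z_def)
  then have "complex_of_real z \<notin> complex_of_real ` {1..}"
    by auto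
  then show ?thesis by (simp add: slit_plane_def)
qed

text \<open>The 4 leaves room for all uses: Re (c + M - 2) > 0 makes \<open>G\<close> continuous at
  t = 1, and Re (c + m + M - 1) > 1 admits the Euler integrals and keeps their prefactors away from
  0.\<close>

lemma M: "real M \<ge> 4 - Re c"
  unfolding M_def by (rule real_nat_ceiling_ge)

lemma one_minus_zt_nonzero: "t \<in> {0..1} \<Longrightarrow> complex_of_real (1 - z * t) \<noteq> 0"
  using pos[of t] by (metis less_irrefl of_real_eq_0_iff)

lemma G_cont:
  assumes "Re p > 0"
  shows "continuous_on {0..1} (G p q)"
proof -
  have "continuous_on {0..1} (\<lambda>t. complex_of_real (1 - z * t) powr (- q))"
  proof (rule continuous_on_powr_complex)
    show "{0..1} \<subseteq> {t. 0 \<le> Re (complex_of_real (1 - z * t)) \<or> Im (complex_of_real (1 - z * t)) \<noteq> 0}"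
      using pos less_imp_le unfolding Re_complex_of_real by blast
    show "0 < Re (- q)" if "t \<in> {0..1}" "complex_of_real (1 - z * t) = 0" for t
      using that one_minus_zt_nonzero by blast
  qed (intro continuous_intros)+
  moreover have "continuous_on {0..1} (\<lambda>t. complex_of_real (1 - t) powr p)"
    using assms by (intro continuous_on_powr_complex continuous_intros) auto
  ultimately show ?thesis
    unfolding G_def[abs_def]
    by (intro continuous_on_mult continuous_on_power continuous_on_of_real continuous_on_id)
qed

lemma G_deriv: "\<exists>g'. (G p q has_vector_derivative g') (at t0)"
proof -
  have p: "1 - z * t0 > 0" "1 - t0 > 0" using pos[of t0] t0 by auto
  have d0: "((\<lambda>t. t ^ M) has_field_derivative of_nat M * of_real t0 ^ (M - 1)) (at (complex_of_real t0))"
    by (rule DERIV_cong[OF DERIV_power[OF DERIV_ident]]) simp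
  have d1: "((\<lambda>t. (1 - t) powr p) has_field_derivative (p * (1 - of_real t0) powr (p - 1)) * (- 1)) (at (complex_of_real t0))"
    by (rule DERIV_chain2[OF has_field_derivative_powr])
      (use p in \<open>auto intro!: derivative_eq_intros simp: complex_nonpos_Reals_iff\<close>)
  have d2: "((\<lambda>t. (1 - of_real z * t) powr (- q)) has_field_derivative
      (- q * (1 - of_real z * of_real t0) powr (- q - 1)) * (- of_real z)) (at (complex_of_real t0))"
    by (rule DERIV_chain2[OF has_field_derivative_powr])
      (use p in \<open>auto intro!: derivative_eq_intros simp: complex_nonpos_Reals_iff\<close>)
  have "\<exists>g'. ((\<lambda>t. t ^ M * (1 - t) powr p * (1 - of_real z * t) powr (- q)) has_field_derivative g') (at (complex_of_real t0))"
    using DERIV_mult[OF DERIV_mult[OF d0 d1] d2] by blast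
  then obtain g' where "((\<lambda>t. t ^ M * (1 - t) powr p * (1 - of_real z * t) powr (- q)) has_field_derivative g') (at (complex_of_real t0))"
    by blast
  from has_vector_derivative_real_field[OF this]
  show ?thesis by (auto simp: G_def[abs_def])
qed

lemma Euler_integral_eq_J:
  "Euler_integral (p + 1 + of_nat m) (q + of_nat m) (m + M) (of_real z) = J (G p q) m"
  unfolding Euler_integral_def J_def
proof (rule integral_cong)
  fix t :: real assume t: "t \<in> {0..1}"
  have 1: "complex_of_real (1 - t) powr (p + of_nat m) = of_real (1 - t) ^ m * of_real (1 - t) powr p"
  \<comment> \<open>At t = 1 both sides are 0, since \<open>0 powr a = 0\<close> for every
    exponent.\<close>
  proof (cases "t = 1")
    case False
    then have "complex_of_real (1 - t) \<noteq> 0" by simp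
    then have "complex_of_real (1 - t) powr of_nat m = of_real (1 - t) ^ m"
      by (intro powr_nat') simp
    then show ?thesis by (simp only: powr_add mult.commute)
  qed simp
  have 2: "complex_of_real (1 - z * t) powr (- q - of_nat m) = of_real (1 - z * t) powr (- q) / of_real (1 - z * t) ^ m"
    using powr_nat'[of "complex_of_real (1 - z * t)" m] one_minus_zt_nonzero[OF t] by (simp only: powr_diff) simp
  have "of_real t ^ (m + M) * complex_of_real (1 - t) powr (p + 1 + of_nat m - 1) * (1 - of_real z * of_real t) powr - (q + of_nat m) =
      of_real t ^ (m + M) * complex_of_real (1 - t) powr (p + of_nat m) * of_real (1 - z * t) powr (- q - of_nat m)"
    by (simp add: algebra_simps)
  also have "\<dots> = of_real ((t * (1 - t) / (1 - z * t)) ^ m) * G p q t"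
    unfolding 1 2 by (simp add: G_def power_add power_mult_distrib power_divide)
  finally show "of_real t ^ (m + M) * complex_of_real (1 - t) powr (p + 1 + of_nat m - 1) * (1 - of_real z * of_real t) powr - (q + of_nat m) =
      of_real ((t * (1 - t) / (1 - z * t)) ^ m) * G p q t" .
qed

definition Jo :: "nat \<Rightarrow> complex" where "Jo = J (G (c + of_nat M - 2) (b + of_nat M))"
definition Je :: "nat \<Rightarrow> complex" where "Je = J (G (c + of_nat M - 1) (b + of_nat M + 1))"
definition ko :: complex where "ko = G (c + of_nat M - 2) (b + of_nat M) t0 * of_real (sqrt s / (1 + s))"
definition ke :: complex where "ke = G (c + of_nat M - 1) (b + of_nat M + 1) t0 * of_real (sqrt s / (1 + s))"

lemma Jo_tends: "tends_half (\<lambda>m. of_real ((1 + s) ^ (2 * m) / \<beta> m) * Jo m) ko"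
proof -
  have "Re (c + of_nat M - 2) > 0" using M by simp
  from G_cont[OF this] show ?thesis
    unfolding Jo_def ko_def using G_deriv laplace_tends by blast
qed

lemma Je_tends: "tends_half (\<lambda>m. of_real ((1 + s) ^ (2 * m) / \<beta> m) * Je m) ke"
proof -
  have "Re (c + of_nat M - 1) > 0" using M by simp
  from G_cont[OF this] show ?thesis
    unfolding Je_def ke_def using G_deriv laplace_tends by blast
qed

lemma t0_facts: "1 - t0 = s / (1 + s)" "1 - z * t0 = s"
  using s by (simp_all add: t0_def z_factor field_simps)

text \<open>The two functions \<open>G\<close> differ by the factor (1 - z t) / (1 - t), which is 1
  + s at t0.\<close>

lemma ko_eq: "ko = of_real (1 + s) * ke"
proof -
  have "1 - t0 \<noteq> 0" "1 - z * t0 \<noteq> 0"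
    using t0_facts s by auto
  then have nz: "complex_of_real (1 - t0) \<noteq> 0" "complex_of_real (1 - z * t0) \<noteq> 0"
    by (metis of_real_eq_0_iff)+
  have 1: "complex_of_real (1 - t0) powr (c + of_nat M - 1) = of_real (1 - t0) powr (c + of_nat M - 2) * of_real (1 - t0)"
    using powr_add[of "complex_of_real (1 - t0)" "c + of_nat M - 2" 1] nz by (simp add: algebra_simps)
  have 2: "complex_of_real (1 - z * t0) powr (- (b + of_nat M)) = of_real (1 - z * t0) powr (- (b + of_nat M + 1)) * of_real (1 - z * t0)"
    using powr_add[of "complex_of_real (1 - z * t0)" "- (b + of_nat M + 1)" 1] nz by (simp add: algebra_simps)
  have "1 - z * t0 = (1 + s) * (1 - t0)"
    unfolding t0_facts using s by simp
  then have "complex_of_real (1 - z * t0) = of_real (1 + s) * of_real (1 - t0)"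
    by (simp only: of_real_mult)
  then show ?thesis
    unfolding ko_def ke_def G_def 1 2 by (simp add: mult_ac)
qed

lemma ke_nonzero: "ke \<noteq> 0"
proof -
  have "complex_of_real (1 - t0) \<noteq> 0" "complex_of_real (sqrt s / (1 + s)) \<noteq> 0" "complex_of_real t0 \<noteq> 0"
    using s t0 by (simp_all only: of_real_eq_0_iff) auto
  moreover have "complex_of_real (1 - z * t0) \<noteq> 0"
    using t0 by (intro one_minus_zt_nonzero) auto
  ultimately show ?thesis
    unfolding ke_def G_def by (simp only: mult_eq_0_iff powr_eq_0_iff power_eq_0_iff) simp
qed

text \<open>The prefactor is arranged so that \<open>P_odd\<close> and \<open>P_even\<close> share
  the same Pochhammer symbol and factorial; in their ratio only two linear factors and the integrals
  remain.\<close>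

lemma P_odd: "P (2 * (m + M) + 1) (of_real z) =
    (c + of_nat (m + M) - 1) * pochhammer (c + of_nat (m + M)) (m + M) / fact (m + M) * Jo m"
proof -
  have "Re (c + of_nat (m + M) - 1) > 1" using M by simp
  from P_odd_integral[OF this z_slit]
  have "P (2 * (m + M) + 1) (of_real z) = pochhammer (c + of_nat (m + M) - 1) (Suc (m + M)) / fact (m + M) * Jo m"
    using Euler_integral_eq_J[of "c + of_nat M - 2" m "b + of_nat M"] by (simp add: Jo_def algebra_simps)
  then show ?thesis
    by (simp add: pochhammer_rec)
qed

lemma P_even: "P (2 * (m + M) + 2) (of_real z) =
    (c + of_nat (2 * (m + M))) * pochhammer (c + of_nat (m + M)) (m + M) / fact (m + M) * Je m"
proof -
  have "Re (c + of_nat (m + M)) > 1" using M by simp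
  from P_even_integral[OF this z_slit]
  have "P (2 * (m + M) + 2) (of_real z) = pochhammer (c + of_nat (m + M)) (Suc (m + M)) / fact (m + M) * Je m"
    using Euler_integral_eq_J[of "c + of_nat M - 1" m "b + of_nat M + 1"] by (simp add: Je_def algebra_simps)
  then show ?thesis
    by (simp add: pochhammer_Suc algebra_simps)
qed


abbreviation R :: "nat \<Rightarrow> complex" where "R \<equiv> Rstar b c (of_real z)"
abbreviation Pz :: "nat \<Rightarrow> complex" where "Pz n \<equiv> P n (of_real z)"

text \<open>The limit of P_n / P_(n+1). It is the larger root in absolute value of x^2 - x + z/4 =
  0, the limiting recurrence; the other root is 1 - \<rho>, and w = (1 - \<rho>) / \<rho>.\<close>

definition \<rho> :: real where "\<rho> = (1 + s) / 2"

lemma Jo_nonzero: "\<forall>\<^sub>F m in sequentially. Jo m \<noteq> 0"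
proof -
  have "ko \<noteq> 0"
    unfolding ko_eq using ke_nonzero s by (simp only: mult_eq_0_iff of_real_eq_0_iff) simp
  from tends_half_nonzero[OF Jo_tends this] show ?thesis
    by eventually_elim auto
qed

lemma Je_nonzero: "\<forall>\<^sub>F m in sequentially. Je m \<noteq> 0"
  using tends_half_nonzero[OF Je_tends ke_nonzero] by eventually_elim auto

lemma prefactor_nonzero:
  "(c + of_nat (m + M) - 1) * pochhammer (c + of_nat (m + M)) (m + M) / fact (m + M) \<noteq> 0"
  "(c + of_nat (2 * (m + M))) * pochhammer (c + of_nat (m + M)) (m + M) / fact (m + M) \<noteq> 0"
proof -
  have "c + of_nat (m + M) - 1 \<noteq> 0"
  proof
    assume "c + of_nat (m + M) - 1 = 0"
    then have "Re (c + of_nat (m + M) - 1) = 0" by simp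
    then show False using M by simp
  qed
  moreover have "pochhammer (c + of_nat (m + M)) (m + M) \<noteq> 0"
    using add_of_nat_nonzero[OF add_of_nat_not_nonpos_Ints[OF c, of "m + M"]]
    by (auto simp: pochhammer_eq_0_iff add_eq_0_iff2)
  ultimately show "(c + of_nat (m + M) - 1) * pochhammer (c + of_nat (m + M)) (m + M) / fact (m + M) \<noteq> 0"
    "(c + of_nat (2 * (m + M))) * pochhammer (c + of_nat (m + M)) (m + M) / fact (m + M) \<noteq> 0"
    using add_of_nat_nonzero[OF c, of "2 * (m + M)"] by (simp_all del: of_nat_add of_nat_mult)
qed

lemma Pz_nonzero: "\<forall>\<^sub>F n in sequentially. Pz n \<noteq> 0"
proof -
  have "\<forall>\<^sub>F m in sequentially. Pz (2 * (m + M) + 1) \<noteq> 0 \<and> Pz (2 * (m + M) + 2) \<noteq> 0"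
    using Jo_nonzero Je_nonzero
  proof eventually_elim
    case (elim m)
    then show ?case
      unfolding P_odd P_even using prefactor_nonzero[of m] by (simp only: mult_eq_0_iff) simp
  qed
  then obtain N where N: "\<And>m. m \<ge> N \<Longrightarrow> Pz (2 * (m + M) + 1) \<noteq> 0 \<and> Pz (2 * (m + M) + 2) \<noteq> 0"
    by (auto simp: eventually_sequentially)
  have "Pz n \<noteq> 0" if n: "n \<ge> 2 * (N + M) + 1" for n
  proof (cases n rule: odd_even_cases)
    case 1
    then show ?thesis using n by simp
  next
    case (2 m)
    then have m: "m - M + M = m" "N \<le> m - M" using n by auto
    show ?thesis using N[OF m(2)] unfolding m(1) 2 by simp
  next
    case (3 m)
    then have m: "m - M + M = m" "N \<le> m - M" using n by auto
    show ?thesis using N[OF m(2)] unfolding m(1) 3 by simp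
  qed
  then show ?thesis
    unfolding eventually_sequentially by blast
qed

lemma R_even_tends: "tends_half (\<lambda>m. R (2 * m + 2)) (- of_real z / 4)"
proof -
  have "R (2 * m + 2) = - of_real z / 4 * ((1 + of_nat m) / (c / 2 + of_nat m) * ((c - b + of_nat m) / ((c + 1) / 2 + of_nat m)))" for m
  proof -
    define d e where "d = c / 2 + of_nat m" and "e = (c + 1) / 2 + of_nat m"
    have "c + of_nat (2 * m) = 2 * d" "c + of_nat (2 * m + 1) = 2 * e"
      by (simp_all add: d_def e_def field_simps)
    then show ?thesis
      unfolding Rstar_even' d_def[symmetric] e_def[symmetric] by (simp add: mult_ac)
  qed
  moreover have "tends_half (\<lambda>m. - of_real z / 4 * ((1 + of_nat m) / (c / 2 + of_nat m) * ((c - b + of_nat m) / ((c + 1) / 2 + of_nat m)))) (- of_real z / 4 * (1 * 1))"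
    by (intro tends_half_mult tends_half_of_nat_ratio tends_half_const)
  ultimately show ?thesis by simp
qed

lemma R_odd_tends: "tends_half (\<lambda>m. R (2 * m + 3)) (- of_real z / 4)"
proof -
  have "R (2 * m + 3) = - of_real z / 4 * ((b + 1 + of_nat m) / ((c + 1) / 2 + of_nat m) * ((c + of_nat m) / ((c + 2) / 2 + of_nat m)))" for m
  proof -
    define d e where "d = (c + 1) / 2 + of_nat m" and "e = (c + 2) / 2 + of_nat m"
    have "c + of_nat (2 * m + 1) = 2 * d" "c + of_nat (2 * m + 2) = 2 * e" "b + of_nat (m + 1) = b + 1 + of_nat m"
      by (simp_all add: d_def e_def field_simps)
    then show ?thesis
      unfolding Rstar_odd' d_def[symmetric] e_def[symmetric] by (simp add: mult_ac)
  qed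
  moreover have "tends_half (\<lambda>m. - of_real z / 4 * ((b + 1 + of_nat m) / ((c + 1) / 2 + of_nat m) * ((c + of_nat m) / ((c + 2) / 2 + of_nat m)))) (- of_real z / 4 * (1 * 1))"
    by (intro tends_half_mult tends_half_of_nat_ratio tends_half_const)
  ultimately show ?thesis by simp
qed

lemma R_tends: "tends_half R (- of_real z / 4)"
proof (rule tends_half_unshift[of _ 2], rule tends_half_even_odd)
  show "tends_half (\<lambda>m. R (2 * m + 2)) (- of_real z / 4)"
    by (rule R_even_tends)
  show "tends_half (\<lambda>m. R (2 * m + 1 + 2)) (- of_real z / 4)"
    using R_odd_tends by (simp add: eval_nat_numeral)
qed

text \<open>The linear prefactors have the quotient 1/2 in the limit, the integrals the quotient 1 +
  s.\<close>

lemma ratio_odd: "tends_half (\<lambda>m. Pz (2 * m + 1) / Pz (2 * m + 2)) (of_real \<rho>)"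
proof (rule tends_half_unshift[of _ M])
  have "ko / ke = of_real (1 + s)"
    using ke_nonzero by (simp add: ko_eq)
  then have "tends_half (\<lambda>m. of_real ((1 + s) ^ (2 * m) / \<beta> m) * Jo m / (of_real ((1 + s) ^ (2 * m) / \<beta> m) * Je m)) (of_real (1 + s))"
    using tends_half_divide[OF Jo_tends Je_tends ke_nonzero] by simp
  moreover have "of_real ((1 + s) ^ (2 * m) / \<beta> m) * Jo m / (of_real ((1 + s) ^ (2 * m) / \<beta> m) * Je m) = Jo m / Je m" for m
  proof -
    have "complex_of_real ((1 + s) ^ (2 * m) / \<beta> m) \<noteq> 0"
      using s \<beta>_pos[of m] by (simp only: of_real_eq_0_iff) simp
    then show ?thesis by (rule mult_divide_mult_cancel_left)
  qed
  ultimately have J: "tends_half (\<lambda>m. Jo m / Je m) (of_real (1 + s))"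
    by simp
  have "tends_half (\<lambda>m. 1 / 2 * ((c + of_nat M - 1 + of_nat m) / (c / 2 + of_nat M + of_nat m)) * (Jo m / Je m)) (1 / 2 * 1 * of_real (1 + s))"
    by (intro tends_half_mult tends_half_of_nat_ratio tends_half_const J)
  moreover have "1 / 2 * ((c + of_nat M - 1 + of_nat m) / (c / 2 + of_nat M + of_nat m)) * (Jo m / Je m) =
      Pz (2 * (m + M) + 1) / Pz (2 * (m + M) + 2)" for m
  proof -
    define d e q where "d = c / 2 + of_nat M + of_nat m" and "e = c + of_nat M - 1 + of_nat m"
      and "q = pochhammer (c + of_nat (m + M)) (m + M) / fact (m + M)"
    have "c + of_nat (2 * (m + M)) = 2 * d" "c + of_nat (m + M) - 1 = e"
      by (simp_all add: d_def e_def field_simps)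
    then have "Pz (2 * (m + M) + 1) = e * q * Jo m" "Pz (2 * (m + M) + 2) = 2 * d * q * Je m"
      unfolding P_odd P_even q_def by simp_all
    moreover have "q \<noteq> 0"
      using prefactor_nonzero[of m] by (auto simp: q_def)
    ultimately show ?thesis
      unfolding d_def[symmetric] e_def[symmetric] by simp
  qed
  ultimately show "tends_half (\<lambda>m. Pz (2 * (m + M) + 1) / Pz (2 * (m + M) + 2)) (of_real \<rho>)"
    by (simp add: \<rho>_def)
qed

lemma \<rho>_sq: "\<rho> * (1 - \<rho>) = z / 4"
  by (simp add: \<rho>_def z_factor field_simps)

lemma \<rho>_pos: "\<rho> > 0"
  using s by (simp add: \<rho>_def)

text \<open>Solved from the recurrence at index 2m + 1 rather than from integrals. The limit is
  right because \<rho> (1 - \<rho>) = z/4; dividing by R in the limit is where z must be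
  nonzero.\<close>

lemma ratio_even: "tends_half (\<lambda>m. Pz (2 * m + 2) / Pz (2 * m + 3)) (of_real \<rho>)"
proof -
  have z: "- complex_of_real z / 4 \<noteq> 0" using z_nonzero by simp
  have "tends_half (\<lambda>m. (Pz (2 * m + 1) / Pz (2 * m + 2) - 1) / R (2 * m + 2)) ((of_real \<rho> - 1) / (- of_real z / 4))"
    by (intro tends_half_divide tends_half_diff ratio_odd R_even_tends tends_half_const z)
  also have "(of_real \<rho> - 1) / (- complex_of_real z / 4) = inverse (of_real \<rho>)"
  proof -
    have "(\<rho> - 1) / (- z / 4) = inverse \<rho>"
    proof -
      have "- z / 4 = (\<rho> - 1) * \<rho>"
        unfolding minus_divide_left[symmetric] \<rho>_sq[symmetric] by (simp add: algebra_simps)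
      moreover have "\<rho> - 1 \<noteq> 0" using s_neq_1 by (simp add: \<rho>_def)
      ultimately show ?thesis by (simp add: inverse_eq_divide)
    qed
    from arg_cong[OF this, of complex_of_real] show ?thesis by simp
  qed
  finally have "tends_half (\<lambda>m. (Pz (2 * m + 1) / Pz (2 * m + 2) - 1) / R (2 * m + 2)) (inverse (of_real \<rho>))" .
  from tends_half_inverse[OF this]
  have "tends_half (\<lambda>m. inverse ((Pz (2 * m + 1) / Pz (2 * m + 2) - 1) / R (2 * m + 2))) (of_real \<rho>)"
    using \<rho>_pos by simp
  moreover have "\<forall>\<^sub>F m in sequentially. inverse ((Pz (2 * m + 1) / Pz (2 * m + 2) - 1) / R (2 * m + 2)) = Pz (2 * m + 2) / Pz (2 * m + 3)"
  proof -
    obtain N where N: "\<And>n. n \<ge> N \<Longrightarrow> Pz n \<noteq> 0"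
      using Pz_nonzero by (auto simp: eventually_sequentially)
    have "inverse ((Pz (2 * m + 1) / Pz (2 * m + 2) - 1) / R (2 * m + 2)) = Pz (2 * m + 2) / Pz (2 * m + 3)" if "m \<ge> N" for m
    proof -
      have nz: "Pz (2 * m + 2) \<noteq> 0" "R (2 * m + 2) \<noteq> 0"
        using N[of "2 * m + 2"] that Rstar_nonzero[of "of_real z" "2 * m + 1"] z_nonzero by auto
      have "Pz (2 * m + 1) = Pz (2 * m + 2) + R (2 * m + 2) * Pz (2 * m + 3)"
        using P_rec[OF z_slit, of "2 * m + 1"] by (simp add: eval_nat_numeral)
      then have "(Pz (2 * m + 1) / Pz (2 * m + 2) - 1) / R (2 * m + 2) = Pz (2 * m + 3) / Pz (2 * m + 2)"
        using nz by (simp add: add_divide_distrib)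
      then show ?thesis by simp
    qed
    then show ?thesis unfolding eventually_sequentially by blast
  qed
  ultimately show ?thesis
    by (rule tends_half_transform)
qed

lemma ratio_tends: "tends_half (\<lambda>n. Pz n / Pz (Suc n)) (of_real \<rho>)"
proof (rule tends_half_unshift[of _ 1], rule tends_half_even_odd)
  show "tends_half (\<lambda>m. Pz (2 * m + 1) / Pz (Suc (2 * m + 1))) (of_real \<rho>)"
    using ratio_odd by simp
  show "tends_half (\<lambda>m. Pz (2 * m + 1 + 1) / Pz (Suc (2 * m + 1 + 1))) (of_real \<rho>)"
    using ratio_even by (simp add: eval_nat_numeral)
qed

lemma w_nonzero: "w \<noteq> 0"
  using s s_neq_1 by (simp add: w_eq)

lemma abs_w: "\<bar>w\<bar> < 1"
proof -
  have "\<bar>1 - s\<bar> < 1 + s" using s by auto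
  then show ?thesis using s by (simp add: w_eq)
qed

sublocale minimal_solution R "\<lambda>n. P n (of_real z)" "of_real w"
proof
  show "R 0 = 1" by (rule Rstar_0)
  show "P 0 (of_real z) = 1" by (simp add: P_def)
  show "Pz n = Pz (Suc n) + R (Suc n) * Pz (Suc (Suc n))" for n
    by (rule P_rec[OF z_slit])
  show "R (Suc n) \<noteq> 0" for n
    using z_nonzero by (intro Rstar_nonzero) simp
  show "\<forall>\<^sub>F n in sequentially. Pz n \<noteq> 0" by (rule Pz_nonzero)
  show "norm (complex_of_real w) < 1" using abs_w by simp
  show "tends_half (\<lambda>n. - R (Suc (Suc n)) * Pz (Suc (Suc (Suc n))) / Pz (Suc n)) (of_real w)"
  proof -
    have shift: "tends_half (\<lambda>n. Pz (n + k) / Pz (Suc (n + k))) (of_real \<rho>)" for k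
      using tends_half_subseq[OF ratio_tends, of "\<lambda>n. n + k"] by simp
    have "tends_half (\<lambda>n. R (n + 2)) (- of_real z / 4)"
      using tends_half_subseq[OF R_tends, of "\<lambda>n. n + 2"] by simp
    then have "tends_half (\<lambda>n. (- 1) * R (n + 2) / ((Pz (n + 1) / Pz (Suc (n + 1))) * (Pz (n + 2) / Pz (Suc (n + 2)))))
        ((- 1) * (- of_real z / 4) / (of_real \<rho> * of_real \<rho>))"
      using \<rho>_pos by (intro tends_half_divide tends_half_mult tends_half_const shift) auto
    also have "(- 1) * (- complex_of_real z / 4) / (of_real \<rho> * of_real \<rho>) = of_real w"
    proof -
      have "(- 1) * (- z / 4) / (\<rho> * \<rho>) = w"
        using s by (simp add: \<rho>_def w_def power2_eq_square)
      from arg_cong[OF this, of complex_of_real] show ?thesis by simp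
    qed
    finally have "tends_half (\<lambda>n. (- 1) * R (n + 2) / ((Pz (n + 1) / Pz (Suc (n + 1))) * (Pz (n + 2) / Pz (Suc (n + 2))))) (of_real w)" .
    moreover have "\<forall>\<^sub>F n in sequentially. (- 1) * R (n + 2) / ((Pz (n + 1) / Pz (Suc (n + 1))) * (Pz (n + 2) / Pz (Suc (n + 2)))) =
        - R (Suc (Suc n)) * Pz (Suc (Suc (Suc n))) / Pz (Suc n)"
    proof -
      obtain N where N: "\<And>n. n \<ge> N \<Longrightarrow> Pz n \<noteq> 0"
        using Pz_nonzero by (auto simp: eventually_sequentially)
      have "(- 1) * R (n + 2) / ((Pz (n + 1) / Pz (Suc (n + 1))) * (Pz (n + 2) / Pz (Suc (n + 2)))) =
        - R (Suc (Suc n)) * Pz (Suc (Suc (Suc n))) / Pz (Suc n)" if "n \<ge> N" for n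
        using N[of "Suc (Suc n)"] that by simp
      then show ?thesis unfolding eventually_sequentially by blast
    qed
    ultimately show ?thesis
      by (rule tends_half_transform)
  qed
  show "\<forall>\<^sub>F n in sequentially. norm (R n) - Re (R n) \<le> 1/2"
  proof -
    have "(\<lambda>n. norm (R n) - Re (R n)) \<longlonglongrightarrow> norm (- complex_of_real z / 4) - Re (- complex_of_real z / 4)"
      by (intro tendsto_intros tends_half_LIMSEQ R_tends)
    \<comment> \<open>The left side is z/2 for positive z and 0 otherwise; z < 1 is exactly what
      puts the limit strictly inside the parabola.\<close>
    moreover have "norm (- complex_of_real z / 4) - Re (- complex_of_real z / 4) < 1/2"
    proof -
      have "z < 1" using s by (simp add: z_def)
      then show ?thesis by (simp add: norm_divide abs_if)
    qed
    ultimately have "\<forall>\<^sub>F n in sequentially. norm (R n) - Re (R n) < 1/2"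
      by (rule order_tendstoD)
    then show ?thesis by (rule eventually_mono) auto
  qed
qed


section \<open>Closed form and constant of the main term\<close>

lemma prodR_odd: "prodR (2 * m + 1) =
    - (of_real z ^ (2 * m + 1) * pochhammer b (Suc m) * pochhammer c m * fact m * pochhammer (c - b) m)
      / (pochhammer c (2 * m + 1) * pochhammer c (2 * m))"
proof (induction m)
  case 0
  show ?case
    using Rstar_1[of "of_real z"] by (simp add: prodR_def)
next
  case (Suc m)
  define x where "x = pochhammer c (2 * m + 1)"
  define y where "y = pochhammer c (2 * m)"
  define d e f where "d = c + of_nat (2 * m)" and "e = c + of_nat (2 * m + 1)" and "f = c + of_nat (2 * m + 2)"
  have p: "pochhammer c (2 * Suc m + 1) = x * e * f" "pochhammer c (2 * Suc m) = y * d * e"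
    by (simp_all add: x_def y_def d_def e_def f_def pochhammer_Suc mult_ac)
  have q: "pochhammer b (Suc (Suc m)) = pochhammer b (Suc m) * (b + of_nat (m + 1))"
    "pochhammer c (Suc m) = pochhammer c m * (c + of_nat m)"
    "pochhammer (c - b) (Suc m) = pochhammer (c - b) m * (c - b + of_nat m)"
    "fact (Suc m) = of_nat (m + 1) * (fact m :: complex)"
    "complex_of_real z ^ (2 * Suc m + 1) = of_real z ^ (2 * m + 1) * of_real z * of_real z"
    by (simp_all add: pochhammer_Suc mult_ac)
  have "prodR (2 * Suc m + 1) = R (2 * m + 3) * (R (2 * m + 2) * prodR (2 * m + 1))"
    using prodR_Suc[of "2 * m + 2"] prodR_Suc[of "2 * m + 1"] by (simp add: eval_nat_numeral)
  moreover have "- (b1 * c1 * u / (e * f)) * (- (a1 * d1 * u / (d * e)) * (- (Z * B * C * F * D) / (x * y))) =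
      - (Z * u * u * (B * b1) * (C * c1) * (a1 * F) * (D * d1)) / (x * e * f * (y * d * e))"
    for a1 b1 c1 d1 B C D F Z u :: complex
    by (simp add: mult_ac)
  ultimately show ?case
    unfolding Suc.IH p q Rstar_even' Rstar_odd' x_def[symmetric] y_def[symmetric]
      d_def[symmetric] e_def[symmetric] f_def[symmetric] by simp
qed

text \<open>What remains of the Pochhammer symbols and factorials once the product of the partial
  numerators is multiplied by two consecutive P; its limit is the Gamma quotient of the
  theorem.\<close>

definition Q :: "nat \<Rightarrow> complex" where
  "Q n = pochhammer b (Suc n) * pochhammer (c - b) n / (pochhammer c n * fact n)"

lemma main_term_even:
  "main_term (2 * (m + M)) = of_real z ^ (2 * (m + M) + 1) * Q (m + M) * (c + of_nat (m + M) - 1) * (Jo m * Je m)"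
proof -
  define n where "n = m + M"
  define Y where "Y = pochhammer (c + of_nat n) n"
  define d where "d = c + of_nat (2 * n)"
  have p1: "pochhammer c (2 * n) = pochhammer c n * Y"
    using pochhammer_product'[of c n n] by (simp only: Y_def mult_2)
  have p: "pochhammer c (2 * n) = pochhammer c n * Y" "pochhammer c (2 * n + 1) = pochhammer c n * Y * d"
    by (simp_all only: p1 d_def pochhammer_Suc Suc_eq_plus1[symmetric])
  have nz: "Y \<noteq> 0" "d \<noteq> 0" "pochhammer c n \<noteq> 0"
  proof -
    show "Y \<noteq> 0"
      using prefactor_nonzero(1)[of m] unfolding n_def[symmetric] Y_def[symmetric] by auto
    show "d \<noteq> 0"
      unfolding d_def by (rule add_of_nat_nonzero[OF c])
    show "pochhammer c n \<noteq> 0"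
      using add_of_nat_nonzero[OF c] by (auto simp: pochhammer_eq_0_iff add_eq_0_iff2)
  qed
  have gen: "- (- (Z * B * C * F * D) / (C * Y * d * (C * Y))) * (e * Y / F * i) * (d * Y / F * j) =
      Z * (B * D / (C * F)) * e * (i * j)"
    if "Y \<noteq> 0" "d \<noteq> 0" "C \<noteq> 0" "F \<noteq> 0" for Z B C D F Y d e i j :: complex
    using that by (simp add: mult_ac)
  have "main_term (2 * n) = - prodR (2 * n + 1) * Pz (2 * n + 1) * Pz (2 * n + 2)"
    by (simp add: main_term_def)
  also have "\<dots> = of_real z ^ (2 * n + 1) * Q n * (c + of_nat n - 1) * (Jo m * Je m)"
    unfolding prodR_odd p
    unfolding n_def P_odd P_even
    unfolding n_def[symmetric] Y_def[symmetric] d_def[symmetric] Q_def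
    using nz by (rule gen) simp
  finally show ?thesis by (simp add: n_def)
qed

text \<open>One factor for each convergent part of \<open>main_term_even\<close>: z from the odd
  power of z, (1 + s)^(4 M) from the offset between m and m + M, the Gamma quotient from
  \<open>Q\<close>, 1/2 from (c + n - 1) / (2 m + 1), 2 pi from the Wallis integrals, and the two
  Laplace limits.\<close>

definition L :: complex where
  "L = of_real z * of_real ((1 + s) ^ (4 * M)) * (Gamma c / (Gamma b * Gamma (c - b))) * (1 / 2 * 1) * of_real (2 * pi) * (ko * ke)"

lemma main_term_even_tends: "tends_half (\<lambda>m. main_term (2 * m) / of_real w ^ (2 * m)) L"
proof (rule tends_half_unshift[of _ M])
  have "tends_half Q (Gamma c / (Gamma b * Gamma (c - b)))"
    unfolding Q_def[abs_def] by (rule pochhammer_ratio_tends_half[OF b c cb])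
  then have Q: "tends_half (\<lambda>m. Q (m + M)) (Gamma c / (Gamma b * Gamma (c - b)))"
    by (rule tends_half_subseq) simp
  have "tends_half (\<lambda>m. of_real z * of_real ((1 + s) ^ (4 * M)) * Q (m + M) *
      (1 / 2 * ((c + of_nat M - 1 + of_nat m) / (1 / 2 + of_nat m))) * of_real ((2 * real m + 1) * (\<beta> m)\<^sup>2) *
      ((of_real ((1 + s) ^ (2 * m) / \<beta> m) * Jo m) * (of_real ((1 + s) ^ (2 * m) / \<beta> m) * Je m))) L"
    unfolding L_def
    by (intro tends_half_mult tends_half_const Q tends_half_of_nat_ratio \<beta>_sq_tends Jo_tends Je_tends)
  moreover have "of_real z * of_real ((1 + s) ^ (4 * M)) * Q (m + M) *
      (1 / 2 * ((c + of_nat M - 1 + of_nat m) / (1 / 2 + of_nat m))) * of_real ((2 * real m + 1) * (\<beta> m)\<^sup>2) *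
      ((of_real ((1 + s) ^ (2 * m) / \<beta> m) * Jo m) * (of_real ((1 + s) ^ (2 * m) / \<beta> m) * Je m)) =
      main_term (2 * (m + M)) / of_real w ^ (2 * (m + M))" for m
  proof -
    define e where "e = c + of_nat (m + M) - 1"
    have e: "c + of_nat M - 1 + of_nat m = e"
      by (simp add: e_def)
    define h where "h = complex_of_real (1 / 2 + real m)"
    have h: "h \<noteq> 0" "1 / 2 + of_nat m = h" "complex_of_real (2 * real m + 1) = 2 * h"
    proof -
      have "1 / 2 + real m \<noteq> 0" by linarith
      then show "h \<noteq> 0" unfolding h_def by (simp only: of_real_eq_0_iff) simp
    qed (simp_all add: h_def)
    define B where "B = complex_of_real (\<beta> m)"
    have B: "B \<noteq> 0"
      using \<beta>_pos[of m] by (simp add: B_def)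
    \<comment> \<open>z / w = (1 + s)^2, so the powers that normalise the two Euler integrals turn
      the power of z in \<open>main_term_even\<close> into the same power of w.\<close>
    have W: "(1 + s) ^ (4 * M) * ((1 + s) ^ (2 * m) * (1 + s) ^ (2 * m)) = z ^ (2 * (m + M)) / w ^ (2 * (m + M))"
    proof -
      have "z / w = (1 + s)\<^sup>2"
        using z_nonzero s by (simp add: w_def)
      then have "z ^ (2 * (m + M)) / w ^ (2 * (m + M)) = ((1 + s)\<^sup>2) ^ (2 * (m + M))"
        by (metis power_divide)
      also have "\<dots> = (1 + s) ^ (4 * M) * ((1 + s) ^ (2 * m) * (1 + s) ^ (2 * m))"
        unfolding power_mult[symmetric] power_add[symmetric] by (rule arg_cong[of _ _ "\<lambda>k. (1 + s) ^ k"]) simp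
      finally show ?thesis ..
    qed
    define V U where "V = complex_of_real ((1 + s) ^ (4 * M))" and "U = complex_of_real ((1 + s) ^ (2 * m))"
    have VU: "V * (U * U) = of_real z ^ (2 * (m + M)) / of_real w ^ (2 * (m + M))"
      using arg_cong[OF W, of complex_of_real] by (simp only: V_def U_def of_real_mult of_real_divide of_real_power)
    have "of_real z * V * Q (m + M) * (1 / 2 * (e / h)) * (2 * h * B\<^sup>2) * ((U / B * Jo m) * (U / B * Je m)) =
        of_real z * (V * (U * U)) * Q (m + M) * e * (Jo m * Je m)"
      using h(1) B by (simp add: power2_eq_square mult_ac)
    also have "\<dots> = main_term (2 * (m + M)) / of_real w ^ (2 * (m + M))"
      unfolding VU main_term_even e_def[symmetric] by simp
    finally show ?thesis
      unfolding e h(2) V_def U_def B_def of_real_mult[of "2 * real m + 1"] h(3)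
      by (simp only: of_real_divide of_real_power)
  qed
  ultimately show "tends_half (\<lambda>m. main_term (2 * (m + M)) / of_real w ^ (2 * (m + M))) L"
    by simp
qed

text \<open>Even indices have been computed; an odd one differs from its predecessor by a ratio
  tending to w, which the additional factor w in the denominator compensates.\<close>

lemma main_term_tends: "tends_half (\<lambda>n. main_term n / of_real w ^ n) L"
proof (rule tends_half_even_odd[OF main_term_even_tends])
  have w0: "complex_of_real w \<noteq> 0" using w_nonzero by simp
  have "tends_half (\<lambda>m. main_term (Suc (2 * m)) / main_term (2 * m)) (of_real w)"
    by (rule tends_half_subseq[OF main_term_ratio]) simp
  then have "tends_half (\<lambda>m. (main_term (2 * m) / of_real w ^ (2 * m)) *
      (main_term (Suc (2 * m)) / main_term (2 * m) / of_real w)) (L * (of_real w / of_real w))"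
    using w0 by (intro tends_half_mult main_term_even_tends tends_half_divide tends_half_const)
  then have *: "tends_half (\<lambda>m. (main_term (2 * m) / of_real w ^ (2 * m)) *
      (main_term (Suc (2 * m)) / main_term (2 * m) / of_real w)) L"
    using w0 by simp
  obtain N where N: "\<And>n. n \<ge> N \<Longrightarrow> main_term n \<noteq> 0"
    using main_term_nonzero by (auto simp: eventually_sequentially)
  have "(main_term (2 * m) / of_real w ^ (2 * m)) * (main_term (Suc (2 * m)) / main_term (2 * m) / of_real w) =
      main_term (2 * m + 1) / of_real w ^ (2 * m + 1)" if "m \<ge> N" for m
    using N[of "2 * m"] that w0 by simp
  then have "\<forall>\<^sub>F m in sequentially. (main_term (2 * m) / of_real w ^ (2 * m)) * (main_term (Suc (2 * m)) / main_term (2 * m) / of_real w) =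
      main_term (2 * m + 1) / of_real w ^ (2 * m + 1)"
    unfolding eventually_sequentially by blast
  from tends_half_transform[OF * this]
  show "tends_half (\<lambda>m. main_term (2 * m + 1) / of_real w ^ (2 * m + 1)) L" .
qed

text \<open>All bases are positive reals, products of powers of s and 1 + s. Written as exponentials
  in \<sigma> = ln s and \<tau> = ln (1 + s), the identity is one between exponents linear in
  \<sigma> and \<tau>, in which \<open>M\<close> cancels. The factor 2 in 1 - w = 2 s / (1 + s)
  absorbs the 1/2 in \<open>L\<close>.\<close>

lemma L_eq: "(1 - of_real w) * L = 2 * of_real pi * Gamma c / (Gamma b * Gamma (c - b))
        * (of_real z * of_real (1 - z) powr (c - b - 1) / of_real (1 + s) powr (2 * c))"
proof -
  define \<sigma> \<tau> where "\<sigma> = complex_of_real (ln s)" and "\<tau> = complex_of_real (ln (1 + s))"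
  have exps: "complex_of_real s = exp \<sigma>" "complex_of_real (1 + s) = exp \<tau>"
    using s by (simp_all add: \<sigma>_def \<tau>_def exp_of_real del: of_real_add)
  have powrs: "complex_of_real s powr a = exp (a * \<sigma>)" "complex_of_real (1 + s) powr a = exp (a * \<tau>)"
    "complex_of_real (s / (1 + s)) powr a = exp (a * (\<sigma> - \<tau>))"
    "complex_of_real (1 - z) powr a = exp (a * (2 * \<sigma>))" for a
  proof -
    have real_powr: "complex_of_real x powr a = exp (a * of_real (ln x))" if "x > 0" for x
      using that by (simp add: powr_def Ln_of_real)
    show "complex_of_real s powr a = exp (a * \<sigma>)" "complex_of_real (1 + s) powr a = exp (a * \<tau>)"
      "complex_of_real (s / (1 + s)) powr a = exp (a * (\<sigma> - \<tau>))"
      using s real_powr[of s] real_powr[of "1 + s"] real_powr[of "s / (1 + s)"]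
      by (simp_all only: \<sigma>_def \<tau>_def) (simp_all add: ln_div)
    have "1 - z = s\<^sup>2" by (simp add: z_def)
    then show "complex_of_real (1 - z) powr a = exp (a * (2 * \<sigma>))"
      using s real_powr[of "s\<^sup>2"] by (simp only: \<sigma>_def) (simp add: ln_realpow)
  qed
  have t0_exp: "complex_of_real t0 ^ M = exp (- (of_nat M * \<tau>))"
  proof -
    have "complex_of_real t0 = exp (- \<tau>)"
      unfolding exp_minus exps(2)[symmetric] by (simp add: t0_def divide_inverse)
    then show ?thesis
      by (simp add: exp_of_nat_mult[symmetric])
  qed
  define r where "r = complex_of_real (sqrt s / (1 + s))"
  have r: "r * r = exp (\<sigma> - 2 * \<tau>)"
  proof -
    have "sqrt s / (1 + s) * (sqrt s / (1 + s)) = s / ((1 + s) * (1 + s))"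
      using s by simp
    then have "r * r = of_real s / (of_real (1 + s) * of_real (1 + s))"
      unfolding r_def by (simp only: of_real_mult[symmetric] of_real_divide[symmetric])
    then show ?thesis
      unfolding exps by (simp add: exp_diff exp_double power2_eq_square)
  qed
  define E where "E = exp (- (of_nat M * \<tau>)) * exp ((c + of_nat M - 1) * (\<sigma> - \<tau>)) * exp (- (b + of_nat M + 1) * \<sigma>)"
  have ke: "ke = E * r"
    unfolding ke_def G_def t0_facts t0_exp powrs r_def[symmetric] E_def by (rule refl)
  have EE: "E * E = exp (2 * (- (of_nat M * \<tau>) + (c + of_nat M - 1) * (\<sigma> - \<tau>) - (b + of_nat M + 1) * \<sigma>))"
    unfolding E_def exp_add[symmetric] by (simp add: algebra_simps)
  have w: "1 - of_real w = 2 * exp (\<sigma> - \<tau>)"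
  proof -
    have "1 - w = 2 * (s / (1 + s))" using s by (simp add: w_eq field_simps)
    from arg_cong[OF this, of complex_of_real]
    have "1 - complex_of_real w = 2 * (of_real s / of_real (1 + s))"
      by (simp only: of_real_mult of_real_divide of_real_diff of_real_1 of_real_numeral)
    then show ?thesis unfolding exps by (simp add: exp_diff)
  qed
  have pw: "complex_of_real ((1 + s) ^ (4 * M)) = exp (4 * of_nat M * \<tau>)"
    unfolding of_real_power exps exp_of_nat_mult[symmetric] by simp
  have "exp (\<sigma> - \<tau>) * exp (4 * of_nat M * \<tau>) * (exp \<tau> * (E * E) * (r * r)) = exp ((c - b - 1) * (2 * \<sigma>)) / exp (2 * c * \<tau>)"
    unfolding EE r exp_add[symmetric] exp_diff[symmetric]
    by (rule arg_cong[of _ _ exp]) (simp add: algebra_simps)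
  then have key: "exp (\<sigma> - \<tau>) * exp (4 * of_nat M * \<tau>) * (ko * ke) = exp ((c - b - 1) * (2 * \<sigma>)) / exp (2 * c * \<tau>)"
    unfolding ko_eq exps ke by (simp only: mult_ac)
  define \<Gamma> where "\<Gamma> = Gamma c / (Gamma b * Gamma (c - b))"
  have "(1 - of_real w) * L = 2 * of_real pi * \<Gamma> * of_real z * (exp (\<sigma> - \<tau>) * exp (4 * of_nat M * \<tau>) * (ko * ke))"
    unfolding L_def w pw \<Gamma>_def[symmetric] by simp
  then show ?thesis
    unfolding key powrs \<Gamma>_def by simp
qed

lemma L_nonzero: "L \<noteq> 0"
proof -
  have "ko \<noteq> 0"
    unfolding ko_eq using ke_nonzero s by (simp only: mult_eq_0_iff of_real_eq_0_iff) simp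
  moreover have "(1 + s) ^ (4 * M) \<noteq> 0" using s by simp
  ultimately show ?thesis
    unfolding L_def using b c cb z_nonzero ke_nonzero
    by (simp only: mult_eq_0_iff divide_eq_0_iff of_real_eq_0_iff) (simp add: Gamma_eq_zero_iff)
qed

theorem trunc_err_tends:
  "tends_half (\<lambda>n. trunc_err b c (of_real z) n / of_real w ^ n) ((1 - of_real w) * L)"
proof -
  have P1: "Pz 1 = hyp2F1 1 b c (of_real z)"
    by (simp add: P_def)
  have "tends_half (\<lambda>n. (trunc_err b c (of_real z) n / main_term n) * (main_term n / of_real w ^ n)) ((1 - of_real w) * L)"
    using tends_half_mult[OF truncation_error main_term_tends]
    by (simp only: trunc_err_def Kstar_def P1)
  moreover have "\<forall>\<^sub>F n in sequentially. (trunc_err b c (of_real z) n / main_term n) * (main_term n / of_real w ^ n) =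
      trunc_err b c (of_real z) n / of_real w ^ n"
    using main_term_nonzero by eventually_elim simp
  ultimately show ?thesis
    by (rule tends_half_transform)
qed

end

section \<open>The case z = 0 and the conclusion\<close>

lemma (in gauss_fraction) trunc_err_0: "trunc_err b c 0 n = 0"
proof -
  have R: "Rstar b c 0 (Suc k) = 0" for k
    by (simp add: Rstar_def)
  have "cfrac (Rstar b c 0) (Suc k) j = 0" for k j
    by (cases j) (simp_all add: R)
  then have "Kstar b c 0 n = 1"
    by (cases n) (simp_all add: Kstar_def Rstar_0)
  \<comment> \<open>\<open>hyp2F1\<close> is a definite description, so even its value at 0 rests on
    the existence of the continuation.\<close>
  moreover have "hyp2F1 1 b c 0 = 1"
  proof -
    obtain f where f: "f holomorphic_on slit_plane" "\<And>u. norm u < 1 \<Longrightarrow> f u = Pser 1 u"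
      using Pser_extends by blast
    have "(0::complex) \<in> slit_plane" using ball_subset_slit_plane by auto
    from P_eqI[OF f this] have "P 1 0 = Pser 1 0"
      using f(2)[of 0] by simp
    then show ?thesis
      by (simp add: P_def Pser_def eval_fps_at_0 fps_hypergeo_0)
  qed
  ultimately show ?thesis
    by (simp add: trunc_err_def)
qed

theorem corollary1p2:
  fixes b c :: complex and z :: real
  assumes "b \<notin> \<int>\<^sub>\<le>\<^sub>0" and "c \<notin> \<int>\<^sub>\<le>\<^sub>0" and "c - b \<notin> \<int>\<^sub>\<le>\<^sub>0"
    and "z < 1"
  shows "asymp_half
    (\<lambda>n. trunc_err b c (of_real z) n)
    (\<lambda>n. 2 * of_real pi * Gamma c / (Gamma b * Gamma (c - b))
        * (of_real z * of_real (1 - z) powr (c - b - 1)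
            / of_real (1 + sqrt (1 - z)) powr (2 * c))
        * of_real (z / (1 + sqrt (1 - z))\<^sup>2) ^ n)"
proof (cases "z = 0")
  case True
  interpret gauss_fraction b c
    using assms by unfold_locales
  show ?thesis
    using trunc_err_0 by (simp add: asymp_half_def True)
next
  case False
  define s where "s = sqrt (1 - z)"
  interpret gauss_asymptotics b c s
    using assms False by unfold_locales (auto simp: s_def)
  have "s\<^sup>2 = 1 - z"
    using assms(4) by (simp add: s_def)
  then have z: "laplace.z s = z"
    using z_def by simp
  define K where "K = 2 * of_real pi * Gamma c / (Gamma b * Gamma (c - b))
        * (of_real z * of_real (1 - z) powr (c - b - 1) / of_real (1 + s) powr (2 * c))"
  have K: "K = (1 - of_real w) * L"
    unfolding L_eq K_def z ..
  have w: "w = z / (1 + s)\<^sup>2"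
    by (simp add: w_def z)
  have nz: "K \<noteq> 0" "complex_of_real w \<noteq> 0"
    using L_nonzero w_nonzero abs_w by (auto simp: K)
  have "tends_half (\<lambda>n. trunc_err b c (of_real z) n / of_real w ^ n) K"
    using trunc_err_tends unfolding K z .
  from tends_half_divide[OF this tends_half_const nz(1)]
  have "tends_half (\<lambda>n. trunc_err b c (of_real z) n / (K * of_real w ^ n)) 1"
    using nz by (simp add: mult.commute)
  \<comment> \<open>Selects the quotient form in \<open>asymp_half\<close>; the other branch belongs
    to z = 0.\<close>
  moreover have "\<not> (\<forall>\<^sub>F n in sequentially. K * of_real w ^ n = 0)"
    using nz by simp
  ultimately show ?thesis
    unfolding asymp_half_def s_def[symmetric] K_def[symmetric] w[symmetric] tends_half_def
    by (simp only: if_False)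
qed

end
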